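(* In a linear stochastic volatility model $(X,Y)$ on $[0,T]$ (as defined in the context), for any $t\in[0,T]$ and any $\lambda>0$, $$\mathbb{E}\,e^{-\lambda X_t}=\lambda\,\mathbb{E}(T_\lambda-X_t)^+,$$ where $T_\lambda$ is an exponential random variable with parameter $\lambda$ (density $\lambda e^{-\lambda r}$ on $r>0$) independent of $X$.
   Context: Linear stochastic volatility model: let $(\Omega,\mathcal{F},\mathbb{P})$ be a complete probability space with a filtration $(\mathcal{F}_t)_{t\in[0,T]}$, $0<T<\infty$, satisfying the usual conditions, $\mathcal{F}=\mathcal{F}_T$. Let $W,Z$ be standard Brownian motions with respect to this filtration, correlated with $d\langle W,Z\rangle_t=\rho\,dt$ for a constant $\rho\in(-1,1)$. The pair $(X,Y)$ satisfies $$dX_t=Y_tX_t\,dW_t,\qquad dY_t=\mu(t,Y_t)\,dt+\sigma(t,Y_t)\,dZ_t,$$ where $X_0,Y_0$ are positive constants and $\mu,\sigma:\mathbb{R}_+\times\mathbb{R}_+\to\mathbb{R}$ are continuous functions such that the equation for $Y$ has a unique strong solution, which is positive and satisfies $\int_0^TY_u^2\,du<\infty$ $\mathbb{P}$-a.s. Then $X_t=X_0\exp\big(\int_0^tY_u\,dW_u-\frac12\int_0^tY_u^2\,du\big)$. The probability space is assumed rich enough to carry $T_\lambda$. Notation: $a^+=\max(a,0)$. *)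

theory Defs
  imports "HOL-Probability.Probability"
begin

text \<open>
  Processes are functions \<open>real \<Rightarrow> 'a \<Rightarrow> real\<close> of time and outcome; only times in \<open>{0..T}\<close> matter.
  A filtration is a family \<open>F :: real \<Rightarrow> 'a measure\<close> of which only the sigma-algebras
  \<open>sets (F t)\<close> are used, the probability always being that of \<open>M\<close>.
\<close>

locale usual_filtered_prob_space = prob_space M + complete_measure M for M :: "'a measure" +
  fixes F :: "real \<Rightarrow> 'a measure" and T :: real
  assumes horizon_pos: "0 < T"
    and filtration_subalgebra: "\<And>t. t \<in> {0..T} \<Longrightarrow> subalgebra M (F t)"
    and filtration_mono: "\<And>s t. 0 \<le> s \<Longrightarrow> s \<le> t \<Longrightarrow> t \<le> T \<Longrightarrow> sets (F s) \<subseteq> sets (F t)"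
    and filtration_null_sets: "null_sets M \<subseteq> sets (F 0)"
    and filtration_right_continuous: "\<And>t. 0 \<le> t \<Longrightarrow> t < T \<Longrightarrow> sets (F t) = (\<Inter>s\<in>{t<..T}. sets (F s))"
    and filtration_final: "sets (F T) = sets M"

definition adapted :: "(real \<Rightarrow> 'a measure) \<Rightarrow> real \<Rightarrow> (real \<Rightarrow> 'a \<Rightarrow> real) \<Rightarrow> bool" where
  "adapted F T A \<longleftrightarrow> (\<forall>t\<in>{0..T}. A t \<in> borel_measurable (F t))"

definition continuous_paths :: "'a measure \<Rightarrow> real \<Rightarrow> (real \<Rightarrow> 'a \<Rightarrow> real) \<Rightarrow> bool" where
  "continuous_paths M T A \<longleftrightarrow> (AE \<omega> in M. continuous_on {0..T} (\<lambda>t. A t \<omega>))"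

text \<open>The events \<open>{A s \<in> E}\<close> with \<open>s \<le> t\<close>: a generator of the sigma-algebra of the process \<open>A\<close>
  up to time \<open>t\<close>.\<close>

definition path_events :: "'a measure \<Rightarrow> (real \<Rightarrow> 'a \<Rightarrow> real) \<Rightarrow> real \<Rightarrow> 'a set set" where
  "path_events M A t = {A s -` E \<inter> space M | s E. s \<in> {0..t} \<and> E \<in> sets borel}"

definition brownian_motion ::
  "'a measure \<Rightarrow> (real \<Rightarrow> 'a measure) \<Rightarrow> real \<Rightarrow> (real \<Rightarrow> 'a \<Rightarrow> real) \<Rightarrow> bool" where
  "brownian_motion M F T B \<longleftrightarrow>
     adapted F T B \<and> continuous_paths M T B \<and>
     (AE \<omega> in M. B 0 \<omega> = 0) \<and>
     (\<forall>s t. 0 \<le> s \<and> s < t \<and> t \<le> T \<longrightarrow>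
        prob_space.indep_set M
          {(\<lambda>\<omega>. B t \<omega> - B s \<omega>) -` E \<inter> space M | E. E \<in> sets borel} (sets (F s))) \<and>
     (\<forall>s t. 0 \<le> s \<and> s < t \<and> t \<le> T \<longrightarrow>
        distributed M lborel (\<lambda>\<omega>. B t \<omega> - B s \<omega>) (normal_density 0 (sqrt (t - s))))"

definition martingale_on ::
  "'a measure \<Rightarrow> (real \<Rightarrow> 'a measure) \<Rightarrow> real \<Rightarrow> (real \<Rightarrow> 'a \<Rightarrow> real) \<Rightarrow> bool" where
  "martingale_on M F T A \<longleftrightarrow>
     adapted F T A \<and> (\<forall>t\<in>{0..T}. integrable M (A t)) \<and>
     (\<forall>s t. 0 \<le> s \<and> s \<le> t \<and> t \<le> T \<longrightarrow> (AE \<omega> in M. real_cond_exp M (F s) (A t) \<omega> = A s \<omega>))"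

text \<open>\<open>cross_variation M F T A B C\<close>: the process \<open>C\<close> is (up to indistinguishability) the bracket
  of the continuous square-integrable martingales \<open>A\<close> and \<open>B\<close>, i.e. the continuous adapted process
  of finite variation, null at time zero, for which \<open>A B - C\<close> is a martingale. Finite variation of
  a path is expressed by its Jordan decomposition.\<close>

definition cross_variation ::
  "'a measure \<Rightarrow> (real \<Rightarrow> 'a measure) \<Rightarrow> real \<Rightarrow>
   (real \<Rightarrow> 'a \<Rightarrow> real) \<Rightarrow> (real \<Rightarrow> 'a \<Rightarrow> real) \<Rightarrow> (real \<Rightarrow> 'a \<Rightarrow> real) \<Rightarrow> bool" where
  "cross_variation M F T A B C \<longleftrightarrow>
     adapted F T C \<and> continuous_paths M T C \<and>
     (AE \<omega> in M. C 0 \<omega> = 0) \<and>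
     (AE \<omega> in M. \<exists>p q. mono_on {0..T} p \<and> mono_on {0..T} q \<and> (\<forall>t\<in>{0..T}. C t \<omega> = p t - q t)) \<and>
     martingale_on M F T (\<lambda>t \<omega>. A t \<omega> * B t \<omega> - C t \<omega>)"

text \<open>Simple integrands \<open>\<Sum>i<n. \<xi> i \<cdot> 1_(\<tau> i, \<tau> (i+1)]\<close> with deterministic grid and bounded
  coefficients, \<open>\<xi> i\<close> being known at time \<open>\<tau> i\<close>.\<close>

definition simple_integrand ::
  "'a measure \<Rightarrow> (real \<Rightarrow> 'a measure) \<Rightarrow> real \<Rightarrow> nat \<Rightarrow> (nat \<Rightarrow> real) \<Rightarrow> (nat \<Rightarrow> 'a \<Rightarrow> real) \<Rightarrow> bool" where
  "simple_integrand M F T n \<tau> \<xi> \<longleftrightarrow>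
     0 \<le> \<tau> 0 \<and> (\<forall>i<n. \<tau> i \<le> \<tau> (Suc i)) \<and> \<tau> n \<le> T \<and>
     (\<forall>i<n. \<xi> i \<in> borel_measurable (F (\<tau> i)) \<and> (\<exists>K. \<forall>\<omega>\<in>space M. \<bar>\<xi> i \<omega>\<bar> \<le> K))"

definition simple_process ::
  "nat \<Rightarrow> (nat \<Rightarrow> real) \<Rightarrow> (nat \<Rightarrow> 'a \<Rightarrow> real) \<Rightarrow> real \<Rightarrow> 'a \<Rightarrow> real" where
  "simple_process n \<tau> \<xi> t \<omega> = (\<Sum>i<n. \<xi> i \<omega> * indicator {\<tau> i<..\<tau> (Suc i)} t)"

definition simple_integral ::
  "(real \<Rightarrow> 'a \<Rightarrow> real) \<Rightarrow> nat \<Rightarrow> (nat \<Rightarrow> real) \<Rightarrow> (nat \<Rightarrow> 'a \<Rightarrow> real) \<Rightarrow> real \<Rightarrow> 'a \<Rightarrow> real" where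
  "simple_integral B n \<tau> \<xi> t \<omega> = (\<Sum>i<n. \<xi> i \<omega> * (B (min t (\<tau> (Suc i))) \<omega> - B (min t (\<tau> i)) \<omega>))"

text \<open>Measurability is demanded explicitly because \<open>measure\<close> vanishes on non-measurable sets.\<close>

definition tends_to_0_in_probability :: "'a measure \<Rightarrow> (nat \<Rightarrow> 'a \<Rightarrow> ennreal) \<Rightarrow> bool" where
  "tends_to_0_in_probability M U \<longleftrightarrow>
     (\<forall>k. U k \<in> borel_measurable M) \<and>
     (\<forall>\<epsilon>>0. (\<lambda>k. measure M {\<omega> \<in> space M. ennreal \<epsilon> < U k \<omega>}) \<longlonglongrightarrow> 0)"

text \<open>\<open>ito_integral M F T B H I\<close>: the process \<open>I\<close> is (up to indistinguishability) the Ito integral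
  \<open>\<integral> H dB\<close> on \<open>{0..T}\<close>. It is the continuous adapted process approximated, uniformly on \<open>{0..T}\<close>
  in probability, by the integrals of simple integrands that approximate \<open>H\<close> in \<open>L\<^sup>2(dt)\<close> in
  probability. Existence of such an approximation characterises the usual class of integrands:
  adapted measurable \<open>H\<close> (up to modification on a \<open>dt \<otimes> P\<close>-null set) with \<open>\<integral>\<^sub>0\<^sup>T H\<^sup>2 dt < \<infinity>\<close> almost
  surely. By the standard estimate for simple integrands, \<open>I\<close> does not depend on the approximation.\<close>

definition ito_integral ::
  "'a measure \<Rightarrow> (real \<Rightarrow> 'a measure) \<Rightarrow> real \<Rightarrow>
   (real \<Rightarrow> 'a \<Rightarrow> real) \<Rightarrow> (real \<Rightarrow> 'a \<Rightarrow> real) \<Rightarrow> (real \<Rightarrow> 'a \<Rightarrow> real) \<Rightarrow> bool" where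
  "ito_integral M F T B H I \<longleftrightarrow>
     adapted F T I \<and> continuous_paths M T I \<and>
     (\<exists>n \<tau> \<xi>.
        (\<forall>k. simple_integrand M F T (n k) (\<tau> k) (\<xi> k)) \<and>
        tends_to_0_in_probability M
          (\<lambda>k \<omega>. \<integral>\<^sup>+u\<in>{0..T}. ennreal ((simple_process (n k) (\<tau> k) (\<xi> k) u \<omega> - H u \<omega>)\<^sup>2) \<partial>lborel) \<and>
        tends_to_0_in_probability M
          (\<lambda>k \<omega>. SUP t\<in>{0..T}. ennreal \<bar>simple_integral B (n k) (\<tau> k) (\<xi> k) t \<omega> - I t \<omega>\<bar>))"

text \<open>\<open>ito_process M F T B b s a A\<close>: \<open>dA\<^sub>t = b\<^sub>t dt + s\<^sub>t dB\<^sub>t\<close> on \<open>{0..T}\<close> with \<open>A\<^sub>0 = a\<close>.\<close>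

definition ito_process ::
  "'a measure \<Rightarrow> (real \<Rightarrow> 'a measure) \<Rightarrow> real \<Rightarrow> (real \<Rightarrow> 'a \<Rightarrow> real) \<Rightarrow>
   (real \<Rightarrow> 'a \<Rightarrow> real) \<Rightarrow> (real \<Rightarrow> 'a \<Rightarrow> real) \<Rightarrow> real \<Rightarrow> (real \<Rightarrow> 'a \<Rightarrow> real) \<Rightarrow> bool" where
  "ito_process M F T B b s a A \<longleftrightarrow>
     adapted F T A \<and> continuous_paths M T A \<and>
     (AE \<omega> in M. set_integrable lborel {0..T} (\<lambda>u. b u \<omega>)) \<and>
     (\<exists>I. ito_integral M F T B s I \<and>
        (AE \<omega> in M. \<forall>t\<in>{0..T}. A t \<omega> = a + set_lebesgue_integral lborel {0..t} (\<lambda>u. b u \<omega>) + I t \<omega>))"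

definition augmented_filtration ::
  "'a measure \<Rightarrow> (real \<Rightarrow> 'a \<Rightarrow> real) \<Rightarrow> real \<Rightarrow> 'a measure" where
  "augmented_filtration M B t = sigma (space M) (path_events M B t \<union> null_sets M)"

text \<open>A strong solution of \<open>dY = \<mu>(t,Y) dt + \<sigma>(t,Y) dB\<close>, \<open>Y\<^sub>0 = y0\<close>, is adapted to the augmented
  filtration of the driving Brownian motion. The coefficients are meaningful on
  \<open>{0..} \<times> {0..}\<close> only, so solutions take values in \<open>{0..}\<close>.\<close>

definition strong_solution ::
  "'a measure \<Rightarrow> real \<Rightarrow> (real \<Rightarrow> 'a \<Rightarrow> real) \<Rightarrow> (real \<Rightarrow> real \<Rightarrow> real) \<Rightarrow> (real \<Rightarrow> real \<Rightarrow> real) \<Rightarrow>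
   real \<Rightarrow> (real \<Rightarrow> 'a \<Rightarrow> real) \<Rightarrow> bool" where
  "strong_solution M T B \<mu> \<sigma> y0 Y \<longleftrightarrow>
     (AE \<omega> in M. \<forall>t\<in>{0..T}. 0 \<le> Y t \<omega>) \<and>
     ito_process M (augmented_filtration M B) T B
       (\<lambda>t \<omega>. \<mu> t (Y t \<omega>)) (\<lambda>t \<omega>. \<sigma> t (Y t \<omega>)) y0 Y"

definition unique_strong_solution ::
  "'a measure \<Rightarrow> real \<Rightarrow> (real \<Rightarrow> 'a \<Rightarrow> real) \<Rightarrow> (real \<Rightarrow> real \<Rightarrow> real) \<Rightarrow> (real \<Rightarrow> real \<Rightarrow> real) \<Rightarrow>
   real \<Rightarrow> (real \<Rightarrow> 'a \<Rightarrow> real) \<Rightarrow> bool" where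
  "unique_strong_solution M T B \<mu> \<sigma> y0 Y \<longleftrightarrow>
     strong_solution M T B \<mu> \<sigma> y0 Y \<and>
     (\<forall>Y'. strong_solution M T B \<mu> \<sigma> y0 Y' \<longrightarrow> (AE \<omega> in M. \<forall>t\<in>{0..T}. Y' t \<omega> = Y t \<omega>))"

locale linear_stochastic_volatility_model = usual_filtered_prob_space M F T
  for M :: "'a measure" and F :: "real \<Rightarrow> 'a measure" and T :: real +
  fixes W Z :: "real \<Rightarrow> 'a \<Rightarrow> real" and \<rho> :: real
    and \<mu> \<sigma> :: "real \<Rightarrow> real \<Rightarrow> real" and x0 y0 :: real
    and X Y :: "real \<Rightarrow> 'a \<Rightarrow> real"
  assumes W_brownian: "brownian_motion M F T W"
    and Z_brownian: "brownian_motion M F T Z"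
    and rho_range: "-1 < \<rho>" "\<rho> < 1"
    and correlation: "cross_variation M F T W Z (\<lambda>t \<omega>. \<rho> * t)"
    and initial_pos: "0 < x0" "0 < y0"
    and mu_continuous: "continuous_on ({0..} \<times> {0..}) (\<lambda>(t, y). \<mu> t y)"
    and sigma_continuous: "continuous_on ({0..} \<times> {0..}) (\<lambda>(t, y). \<sigma> t y)"
    and Y_solution: "unique_strong_solution M T Z \<mu> \<sigma> y0 Y"
    and Y_pos: "AE \<omega> in M. \<forall>t\<in>{0..T}. 0 < Y t \<omega>"
    and Y_square_integrable: "AE \<omega> in M. (\<integral>\<^sup>+u\<in>{0..T}. ennreal ((Y u \<omega>)\<^sup>2) \<partial>lborel) < \<infinity>"
    and X_equation: "ito_process M F T W (\<lambda>t \<omega>. 0) (\<lambda>t \<omega>. Y t \<omega> * X t \<omega>) x0 X"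

end

(* The payoff identity E[lam (T_lam - x)^+] = exp (-lam x) holds for x >= 0 only, so the point is
   that X is almost surely nonnegative. With f(v) = (v^-)^3, Ito's formula and
   v^2 f''(v) = 6 f(v) formally give d E f(X) = 3 E[Y^2 f(X)] dt, hence E f(X_t) = 0 by Gronwall,
   as f(x0) = 0. This is carried out for the simple integrals approximating X: on a
   fine grid Ito's formula reduces to a third-order Taylor expansion and the moments of Gaussian
   increments, and the localisation is a stopping rule that only looks at grid points. *)

theory Submission
  imports Defs
begin

subsection \<open>Grids and the cubed negative part\<close>

text \<open>The cube is chosen because its second derivative is 6 times the negative part, which is
  Lipschitz: the Taylor remainder is then at most |d|^3, and over a Gaussian grid of mesh h such
  remainders add up to order sqrt h. For the square the second derivative would jump at 0.

  Two obstacles shape the argument. The moment of f(X) need not be finite a priori, so only moments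
  of stopped simple integrals are ever taken; Markov's inequality and closeness in probability carry
  the conclusion over to X. Moreover the simple integrand approximates Y X, not Y times the simple
  integral, and only in probability, so the Gronwall inequality carries an error term that must be
  bounded path by path.

  The order of choices matters: first a bound K on the paths and a tolerance \<epsilon>, next a
  simple integrand, whose bound C may be huge compared with 1/\<epsilon>, and last the mesh h, so
  that C^3 sqrt h is small.\<close>

lemma mono_upto_if_Suc:
  fixes s :: "nat \<Rightarrow> 'b :: order"
  assumes "\<And>i. i < n \<Longrightarrow> s i \<le> s (Suc i)" "i \<le> j" "j \<le> n"
  shows "s i \<le> s j"
  using assms(2,3)
proof (induction j rule: dec_induct)
  case (step m)
  then show ?case
    using assms(1)[of m] by simp
qed simp

lemma fine_grid_avoiding_finite_set:
  fixes t h :: real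
  assumes "finite P" "0 \<le> t" "0 < h"
  shows "\<exists>N s. s 0 = 0 \<and> s N = t \<and>
    (\<forall>j<N. s j < s (Suc j) \<and> s (Suc j) - s j \<le> h \<and> (\<forall>p\<in>P. p \<le> s j \<or> s (Suc j) \<le> p))"
proof -
  define Q where "Q = {0, t} \<union> (P \<inter> {0..t}) \<union> ((\<lambda>i. real i * h) ` {..nat \<lceil>t / h\<rceil>} \<inter> {0..t})"
  have finQ: "finite Q" and Qsub: "Q \<subseteq> {0..t}" and Q0: "0 \<in> Q" and Qt: "t \<in> Q"
    using assms by (auto simp: Q_def)
  have Qh: "real i * h \<in> Q" if "real i * h \<le> t" for i
  proof -
    have "real i \<le> t / h"
      using that assms(3) by (simp add: field_simps)
    then have "i \<le> nat \<lceil>t / h\<rceil>"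
      by linarith
    then show ?thesis
      using that assms by (auto simp: Q_def)
  qed
  define L where "L = sorted_list_of_set Q"
  have setL: "set L = Q" and sL: "sorted_wrt (<) L"
    using finQ by (auto simp: L_def)
  define N where "N = length L - 1"
  have lenL: "length L = Suc N"
    using Q0 setL by (cases L) (auto simp: N_def)
  have less: "L ! i < L ! j" if "i < j" "j \<le> N" for i j
    using sorted_wrt_nth_less[OF sL] that lenL by simp
  have le: "L ! i \<le> L ! j" if "i \<le> j" "j \<le> N" for i j
    using less[of i j] that by (cases "i = j") auto
  have inQ: "L ! i \<in> Q" if "i \<le> N" for i
    using nth_mem[of i L] that lenL setL by simp
  have index: "\<exists>i\<le>N. q = L ! i" if "q \<in> Q" for q
    using that setL lenL by (metis in_set_conv_nth less_Suc_eq_le)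
  have gap: "q \<le> L ! j \<or> L ! Suc j \<le> q" if "q \<in> Q" "j < N" for q j
  proof -
    obtain i where "i \<le> N" "q = L ! i" using index[OF \<open>q \<in> Q\<close>] by blast
    then show ?thesis
      using le[of i j] le[of "Suc j" i] that by (cases "i \<le> j") auto
  qed
  have "L ! 0 = 0"
    using index[OF Q0] le[of 0] inQ[of 0] Qsub by force
  moreover have "L ! N = t"
    using index[OF Qt] le[of _ N] inQ[of N] Qsub by force
  moreover have "L ! Suc j - L ! j \<le> h" if "j < N" for j
  proof (rule ccontr)
    assume gt: "\<not> ?thesis"
    \<comment> \<open>\<open>real i * h\<close> is the first multiple of \<open>h\<close> strictly
      above \<open>L ! j\<close> and exceeds it by at most \<open>h\<close>; in a gap longer than
      \<open>h\<close> it would lie strictly between two neighbours of the sorted list.\<close>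
    define i where "i = Suc (nat \<lfloor>L ! j / h\<rfloor>)"
    have nn: "0 \<le> L ! j" and up: "L ! Suc j \<le> t"
      using inQ[of j] inQ[of "Suc j"] Qsub that by auto
    have "real i = of_int \<lfloor>L ! j / h\<rfloor> + 1"
      using nn assms(3) by (simp add: i_def)
    then have "L ! j / h < real i" "real i \<le> L ! j / h + 1"
      by linarith+
    then have "L ! j < real i * h" "real i * h \<le> L ! j + h"
      using assms(3) by (auto simp: field_simps)
    then show False
      using gap[OF Qh that, of i] gt up by linarith
  qed
  moreover have "p \<le> L ! j \<or> L ! Suc j \<le> p" if "j < N" "p \<in> P" for j p
  proof (cases "p \<in> {0..t}")
    case True
    then show ?thesis using gap[OF _ \<open>j < N\<close>, of p] that by (auto simp: Q_def)
  next
    case False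
    then show ?thesis using inQ[of j] inQ[of "Suc j"] Qsub that by force
  qed
  ultimately show ?thesis
    using less by (intro exI[of _ N] exI[of _ "(!) L"]) auto
qed

definition neg_part :: "real \<Rightarrow> real" where
  "neg_part v = max (- v) 0"

lemma neg_part_nonneg [simp]: "0 \<le> neg_part v"
  by (simp add: neg_part_def)

lemma neg_part_le_abs: "neg_part v \<le> \<bar>v\<bar>"
  by (simp add: neg_part_def)

text \<open>This is what turns the second-order term into a multiple of f itself, so that Gronwall's
  inequality closes.\<close>

lemma neg_part_mult_square: "neg_part v * v\<^sup>2 = neg_part v ^ 3"
  by (simp add: neg_part_def max_def power2_eq_square power3_eq_cube)

lemma borel_measurable_neg_part [measurable]: "neg_part \<in> borel_measurable borel"
  unfolding neg_part_def by measurable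

text \<open>The coefficients are f' and f''/2 for f the cubed negative part; f'' has Lipschitz
  constant 6, hence the factor 1 at |d|^3. With p = \<open>neg_part v\<close>, either v + d < 0 and
  the left side is at most (p - d)^3, or it vanishes and p (p^2 - 3 p d + 3 d^2) is nonnegative by
  completing the square.\<close>

lemma neg_part_cube_taylor:
  "neg_part (v + d) ^ 3 \<le>
     neg_part v ^ 3 - 3 * (neg_part v)\<^sup>2 * d + 3 * neg_part v * d\<^sup>2 + \<bar>d\<bar> ^ 3"
proof -
  define p where "p = neg_part v"
  have p: "0 \<le> p" "- v \<le> p"
    by (auto simp: p_def neg_part_def)
  show ?thesis
  proof (cases "0 < - (v + d)")
    case True
    then have "neg_part (v + d) ^ 3 \<le> (p - d) ^ 3"
      using p by (intro power_mono) (auto simp: neg_part_def)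
    also have "\<dots> = p ^ 3 - 3 * p\<^sup>2 * d + 3 * p * d\<^sup>2 - d ^ 3"
      by (simp add: power2_eq_square power3_eq_cube algebra_simps)
    finally show ?thesis
      using abs_ge_minus_self[of "d ^ 3"] by (simp add: p_def power_abs)
  next
    case False
    have "p ^ 3 - 3 * p\<^sup>2 * d + 3 * p * d\<^sup>2 = p * ((p - 3 / 2 * d)\<^sup>2 + 3 / 4 * d\<^sup>2)"
      by (simp add: power2_eq_square power3_eq_cube algebra_simps)
    also have "\<dots> \<ge> 0"
      using p by (intro mult_nonneg_nonneg add_nonneg_nonneg) auto
    finally have "0 \<le> p ^ 3 - 3 * p\<^sup>2 * d + 3 * p * d\<^sup>2 + \<bar>d\<bar> ^ 3"
      by (intro add_nonneg_nonneg[of _ "\<bar>d\<bar> ^ 3"]) auto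
    then show ?thesis
      using False by (simp add: p_def neg_part_def)
  qed
qed

text \<open>Independence is given on the level of events, both for Brownian increments and for the
  exponential variable, whereas product formulas for expectations need \<open>indep_var\<close>.
  Preimages of Borel sets are closed under intersection, so independence passes to the
  sigma-algebras they generate.\<close>

lemma (in prob_space) indep_var_if_indep_set:
  assumes "indep_set {A -` E \<inter> space M | E. E \<in> sets borel} S"
    and A: "A \<in> borel_measurable M" and B: "B \<in> borel_measurable M"
    and "\<And>E. E \<in> sets borel \<Longrightarrow> B -` E \<inter> space M \<in> S"
  shows "indep_var borel (A :: 'a \<Rightarrow> real) borel (B :: 'a \<Rightarrow> real)"
proof -
  have stable: "Int_stable {C -` E \<inter> space M | E. E \<in> sets (borel :: real measure)}" for C :: "'a \<Rightarrow> real"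
    unfolding Int_stable_def
  proof safe
    fix E E' :: "real set" assume "E \<in> sets borel" "E' \<in> sets borel"
    then show "\<exists>E''. (C -` E \<inter> space M) \<inter> (C -` E' \<inter> space M) = C -` E'' \<inter> space M \<and> E'' \<in> sets borel"
      by (intro exI[of _ "E \<inter> E'"]) auto
  qed
  have "indep_set {A -` E \<inter> space M | E. E \<in> sets borel} {B -` E \<inter> space M | E. E \<in> sets borel}"
    using assms(1) unfolding indep_set_def
    by (rule indep_sets_mono_sets) (use assms(4) in \<open>auto split: bool.splits\<close>)
  then show ?thesis
    using A B by (simp add: indep_var_eq indep_set_sigma_sets stable)
qed

lemma (in prob_space) indep_var_square:
  assumes "indep_var borel A borel B"
  shows "indep_var borel (\<lambda>\<omega>. (A \<omega> :: real)\<^sup>2) borel (B :: 'a \<Rightarrow> real)"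
proof -
  have "indep_var borel ((\<lambda>x. x\<^sup>2) \<circ> A) borel ((\<lambda>x. x) \<circ> B)"
    by (rule indep_var_compose[OF assms]) measurable
  then show ?thesis
    unfolding comp_def .
qed

subsection \<open>One-step and Gronwall estimates\<close>

context usual_filtered_prob_space
begin

lemma space_filtration: "s \<in> {0..T} \<Longrightarrow> space (F s) = space M"
  using filtration_subalgebra[of s] by (simp add: subalgebra_def)

lemma measurable_filtration_mono:
  assumes "\<phi> \<in> borel_measurable (F s)" "0 \<le> s" "s \<le> u" "u \<le> T"
  shows "\<phi> \<in> borel_measurable (F u)"
  using measurable_mono[OF order_refl refl, of "F s" "F u" borel] assms
    filtration_mono[of s u] space_filtration[of s] space_filtration[of u] by auto

lemma measurable_filtration:
  assumes "\<phi> \<in> borel_measurable (F s)" "s \<in> {0..T}"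
  shows "\<phi> \<in> borel_measurable M"
  using measurable_from_subalg[OF filtration_subalgebra] assms by blast

lemma brownian_increment_indep:
  assumes B: "brownian_motion M F T B" and s: "0 \<le> s" "s < u" "u \<le> T"
    and \<phi>: "\<phi> \<in> borel_measurable (F s)"
  shows "indep_var borel (\<lambda>\<omega>. B u \<omega> - B s \<omega>) borel \<phi>"
proof (rule indep_var_if_indep_set)
  show "indep_set {(\<lambda>\<omega>. B u \<omega> - B s \<omega>) -` E \<inter> space M |E. E \<in> sets borel} (sets (F s))"
    using B s unfolding brownian_motion_def by blast
  have "distributed M lborel (\<lambda>\<omega>. B u \<omega> - B s \<omega>) (normal_density 0 (sqrt (u - s)))"
    using B s unfolding brownian_motion_def by blast
  then show "(\<lambda>\<omega>. B u \<omega> - B s \<omega>) \<in> borel_measurable M"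
    by (auto simp: distributed_def)
  show "\<phi> \<in> borel_measurable M"
    using measurable_filtration[OF \<phi>] s by auto
  show "\<phi> -` E \<inter> space M \<in> sets (F s)" if "E \<in> sets borel" for E
    using measurable_sets[OF \<phi> that] space_filtration[of s] s by simp
qed

text \<open>The cubic moment is of order (u - s)^(3/2), which is why Taylor remainders vanish in the
  limit of fine grids. Its exact value has an extra factor \<open>sqrt (2 / pi)\<close>, estimated
  by 1.\<close>

lemma brownian_increment_moments:
  assumes B: "brownian_motion M F T B" and s: "0 \<le> s" "s < u" "u \<le> T"
  shows "has_bochner_integral M (\<lambda>\<omega>. B u \<omega> - B s \<omega>) 0"
    and "has_bochner_integral M (\<lambda>\<omega>. (B u \<omega> - B s \<omega>)\<^sup>2) (u - s)"
    and "integrable M (\<lambda>\<omega>. \<bar>B u \<omega> - B s \<omega>\<bar> ^ 3)"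
    and "(\<integral>\<omega>. \<bar>B u \<omega> - B s \<omega>\<bar> ^ 3 \<partial>M) \<le> 2 * (u - s) * sqrt (u - s)"
proof -
  define \<sigma> where "\<sigma> = sqrt (u - s)"
  have \<sigma>: "0 < \<sigma>" "\<sigma>\<^sup>2 = u - s"
    using s by (auto simp: \<sigma>_def)
  have D: "distributed M lborel (\<lambda>\<omega>. B u \<omega> - B s \<omega>) (\<lambda>x. ennreal (normal_density 0 \<sigma> x))"
    using B s unfolding brownian_motion_def \<sigma>_def by blast
  have transfer: "has_bochner_integral M (\<lambda>\<omega>. g (B u \<omega> - B s \<omega>)) I"
    if "has_bochner_integral lborel (\<lambda>x. normal_density 0 \<sigma> x * g x) I" "g \<in> borel_measurable borel"
    for g :: "real \<Rightarrow> real" and I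
    using that distributed_integrable[OF D, of g] distributed_integral[OF D, of g]
    by (simp add: has_bochner_integral_iff)
  show "has_bochner_integral M (\<lambda>\<omega>. B u \<omega> - B s \<omega>) 0"
    using transfer[of "\<lambda>x. x" 0] normal_moment_odd[OF \<sigma>(1), of 0 0] by simp
  show "has_bochner_integral M (\<lambda>\<omega>. (B u \<omega> - B s \<omega>)\<^sup>2) (u - s)"
    using transfer[of "\<lambda>x. x\<^sup>2" "u - s"] normal_moment_even[OF \<sigma>(1), of 0 1] \<sigma>
    by (simp add: diff_divide_distrib)
  have cube: "has_bochner_integral M (\<lambda>\<omega>. \<bar>B u \<omega> - B s \<omega>\<bar> ^ 3) (2 * \<sigma> ^ 3 * sqrt (2 / pi))"
    using transfer[of "\<lambda>x. \<bar>x\<bar> ^ 3"] normal_moment_abs_odd[OF \<sigma>(1), of 0 1]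
    by (simp add: numeral_3_eq_3)
  then show "integrable M (\<lambda>\<omega>. \<bar>B u \<omega> - B s \<omega>\<bar> ^ 3)"
    by (simp add: has_bochner_integral_iff)
  have "sqrt (2 / pi) \<le> 1"
    using pi_ge_two by simp
  then have "2 * \<sigma> ^ 3 * sqrt (2 / pi) \<le> 2 * \<sigma> ^ 3 * 1"
    using \<sigma> by (intro mult_left_mono) auto
  also have "\<dots> = 2 * (u - s) * sqrt (u - s)"
    using \<sigma> by (simp add: \<sigma>_def power3_eq_cube power2_eq_square)
  finally show "(\<integral>\<omega>. \<bar>B u \<omega> - B s \<omega>\<bar> ^ 3 \<partial>M) \<le> 2 * (u - s) * sqrt (u - s)"
    using cube by (simp add: has_bochner_integral_iff)
qed

text \<open>Taylor expansion at \<open>V\<close> with d = \<zeta> times the increment: by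
  independence from \<open>F s\<close> the linear term has mean zero and the squared increment
  contributes u - s. \<open>V\<close> itself is unbounded, its past increments being Gaussian; a
  bound where \<open>\<zeta>\<close> is nonzero suffices to make the coefficients
  integrable.\<close>

lemma expectation_neg_part_cube_step:
  assumes B: "brownian_motion M F T B" and s: "0 \<le> s" "s < u" "u \<le> T"
    and V: "V \<in> borel_measurable (F s)" and \<zeta>: "\<zeta> \<in> borel_measurable (F s)"
    and C: "\<And>\<omega>. \<omega> \<in> space M \<Longrightarrow> \<bar>\<zeta> \<omega>\<bar> \<le> C"
    and R: "\<And>\<omega>. \<omega> \<in> space M \<Longrightarrow> \<zeta> \<omega> \<noteq> 0 \<Longrightarrow> \<bar>V \<omega>\<bar> \<le> R" "0 \<le> R"
    and int: "integrable M (\<lambda>\<omega>. neg_part (V \<omega>) ^ 3)"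
  shows "integrable M (\<lambda>\<omega>. neg_part (V \<omega> + \<zeta> \<omega> * (B u \<omega> - B s \<omega>)) ^ 3)"
    and "integrable M (\<lambda>\<omega>. 3 * neg_part (V \<omega>) * (\<zeta> \<omega>)\<^sup>2)"
    and "expectation (\<lambda>\<omega>. neg_part (V \<omega> + \<zeta> \<omega> * (B u \<omega> - B s \<omega>)) ^ 3) \<le>
      expectation (\<lambda>\<omega>. neg_part (V \<omega>) ^ 3)
      + (u - s) * expectation (\<lambda>\<omega>. 3 * neg_part (V \<omega>) * (\<zeta> \<omega>)\<^sup>2)
      + 2 * C ^ 3 * (u - s) * sqrt (u - s)"
proof -
  define D where "D = (\<lambda>\<omega>. B u \<omega> - B s \<omega>)"
  \<comment> \<open>\<open>\<alpha>\<close> is -f'(V) \<zeta> and \<open>\<beta>\<close> is f''(V)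
    \<zeta>^2 / 2; both are known at time \<open>s\<close>, and bounded because they vanish together
    with \<open>\<zeta>\<close>.\<close>
  define \<alpha> where "\<alpha> = (\<lambda>\<omega>. 3 * (neg_part (V \<omega>))\<^sup>2 * \<zeta> \<omega>)"
  define \<beta> where "\<beta> = (\<lambda>\<omega>. 3 * neg_part (V \<omega>) * (\<zeta> \<omega>)\<^sup>2)"
  have sT: "s \<in> {0..T}"
    using s by auto
  have C0: "0 \<le> C"
    using C not_empty by (metis abs_ge_zero all_not_in_conv order_trans)
  note V_M [measurable] = measurable_filtration[OF V sT]
  note \<zeta>_M [measurable] = measurable_filtration[OF \<zeta> sT]
  have \<alpha>_F: "\<alpha> \<in> borel_measurable (F s)" and \<beta>_F: "\<beta> \<in> borel_measurable (F s)"
    unfolding \<alpha>_def \<beta>_def using V \<zeta> by measurable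
  note [measurable] = measurable_filtration[OF \<alpha>_F sT] measurable_filtration[OF \<beta>_F sT]
  have negR: "neg_part (V \<omega>) \<le> R" if "\<omega> \<in> space M" "\<zeta> \<omega> \<noteq> 0" for \<omega>
    using R(1)[OF that] neg_part_le_abs[of "V \<omega>"] by linarith
  have "\<bar>\<alpha> \<omega>\<bar> \<le> 3 * R\<^sup>2 * C" if "\<omega> \<in> space M" for \<omega>
  proof (cases "\<zeta> \<omega> = 0")
    case False
    then show ?thesis
      unfolding \<alpha>_def abs_mult using negR[OF that] C[OF that] R(2)
      by (intro mult_mono) (auto intro: power_mono)
  qed (use R C0 in \<open>auto simp: \<alpha>_def\<close>)
  then have \<alpha>_int: "integrable M \<alpha>"
    by (intro integrable_const_bound[where B = "3 * R\<^sup>2 * C"]) auto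
  have "\<bar>\<beta> \<omega>\<bar> \<le> 3 * R * C\<^sup>2" if "\<omega> \<in> space M" for \<omega>
  proof (cases "\<zeta> \<omega> = 0")
    case False
    then show ?thesis
      unfolding \<beta>_def abs_mult using negR[OF that] power_mono[OF C[OF that], of 2] R(2)
      by (intro mult_mono) auto
  qed (use R C0 in \<open>auto simp: \<beta>_def\<close>)
  then have \<beta>_int: "integrable M \<beta>"
    by (intro integrable_const_bound[where B = "3 * R * C\<^sup>2"]) auto
  then show "integrable M (\<lambda>\<omega>. 3 * neg_part (V \<omega>) * (\<zeta> \<omega>)\<^sup>2)"
    by (simp add: \<beta>_def)
  have D_int: "integrable M D" "integrable M (\<lambda>\<omega>. (D \<omega>)\<^sup>2)" "expectation D = 0"
    "expectation (\<lambda>\<omega>. (D \<omega>)\<^sup>2) = u - s"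
    using brownian_increment_moments(1,2)[OF B s] by (auto simp: has_bochner_integral_iff D_def)
  have D3_int: "integrable M (\<lambda>\<omega>. \<bar>D \<omega>\<bar> ^ 3)"
    and D3: "expectation (\<lambda>\<omega>. \<bar>D \<omega>\<bar> ^ 3) \<le> 2 * (u - s) * sqrt (u - s)"
    using brownian_increment_moments(3,4)[OF B s] by (auto simp: D_def)
  have [measurable]: "D \<in> borel_measurable M"
    using D_int(1) by auto
  have indep1: "indep_var borel D borel \<alpha>"
    using brownian_increment_indep[OF B s \<alpha>_F] by (simp add: D_def)
  have "indep_var borel D borel \<beta>"
    using brownian_increment_indep[OF B s \<beta>_F] by (simp add: D_def)
  then have indep2: "indep_var borel (\<lambda>\<omega>. (D \<omega>)\<^sup>2) borel \<beta>"
    by (rule indep_var_square)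
  note D\<alpha> = indep_var_integrable[OF indep1 D_int(1) \<alpha>_int]
    indep_var_lebesgue_integral[OF indep1 D_int(1) \<alpha>_int]
  note D\<beta> = indep_var_integrable[OF indep2 D_int(2) \<beta>_int]
    indep_var_lebesgue_integral[OF indep2 D_int(2) \<beta>_int]
  define U where "U = (\<lambda>\<omega>. neg_part (V \<omega>) ^ 3 - D \<omega> * \<alpha> \<omega> + (D \<omega>)\<^sup>2 * \<beta> \<omega> + C ^ 3 * \<bar>D \<omega>\<bar> ^ 3)"
  have U_int: "integrable M U"
    unfolding U_def using int D\<alpha>(1) D\<beta>(1) D3_int by (intro Bochner_Integration.integrable_add
      Bochner_Integration.integrable_diff integrable_mult_right) auto
  have EU: "expectation U \<le> expectation (\<lambda>\<omega>. neg_part (V \<omega>) ^ 3) + (u - s) * expectation \<beta>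
      + 2 * C ^ 3 * (u - s) * sqrt (u - s)"
  proof -
    have "expectation U = expectation (\<lambda>\<omega>. neg_part (V \<omega>) ^ 3) + (u - s) * expectation \<beta>
        + C ^ 3 * expectation (\<lambda>\<omega>. \<bar>D \<omega>\<bar> ^ 3)"
      unfolding U_def using int D\<alpha> D\<beta> D3_int D_int by simp
    then show ?thesis
      using mult_left_mono[OF D3, of "C ^ 3"] C0 by (simp add: algebra_simps)
  qed
  have bound: "neg_part (V \<omega> + \<zeta> \<omega> * D \<omega>) ^ 3 \<le> U \<omega>" if "\<omega> \<in> space M" for \<omega>
  proof -
    have "\<bar>\<zeta> \<omega> * D \<omega>\<bar> ^ 3 \<le> C ^ 3 * \<bar>D \<omega>\<bar> ^ 3"
      unfolding abs_mult power_mult_distrib using C[OF that] by (intro mult_right_mono power_mono) auto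
    then show ?thesis
      using neg_part_cube_taylor[of "V \<omega>" "\<zeta> \<omega> * D \<omega>"]
      by (simp add: U_def \<alpha>_def \<beta>_def power_mult_distrib algebra_simps)
  qed
  show int': "integrable M (\<lambda>\<omega>. neg_part (V \<omega> + \<zeta> \<omega> * (B u \<omega> - B s \<omega>)) ^ 3)"
  proof (rule Bochner_Integration.integrable_bound[OF U_int])
    have "(\<lambda>\<omega>. neg_part (V \<omega> + \<zeta> \<omega> * D \<omega>) ^ 3) \<in> borel_measurable M"
      by measurable
    then show "(\<lambda>\<omega>. neg_part (V \<omega> + \<zeta> \<omega> * (B u \<omega> - B s \<omega>)) ^ 3) \<in> borel_measurable M"
      by (simp add: D_def)
    show "AE \<omega> in M. norm (neg_part (V \<omega> + \<zeta> \<omega> * (B u \<omega> - B s \<omega>)) ^ 3) \<le> norm (U \<omega>)"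
      using bound by (intro AE_I2) (simp add: D_def, meson abs_ge_self order_trans)
  qed
  have "expectation (\<lambda>\<omega>. neg_part (V \<omega> + \<zeta> \<omega> * (B u \<omega> - B s \<omega>)) ^ 3) \<le> expectation U"
    using bound by (intro integral_mono int' U_int) (simp add: D_def)
  with EU show "expectation (\<lambda>\<omega>. neg_part (V \<omega> + \<zeta> \<omega> * (B u \<omega> - B s \<omega>)) ^ 3) \<le>
      expectation (\<lambda>\<omega>. neg_part (V \<omega>) ^ 3)
      + (u - s) * expectation (\<lambda>\<omega>. 3 * neg_part (V \<omega>) * (\<zeta> \<omega>)\<^sup>2)
      + 2 * C ^ 3 * (u - s) * sqrt (u - s)"
    by (simp add: \<beta>_def)
qed

text \<open>Discrete Gronwall: the moments satisfy a(i+1) <= (1 + c \<delta>) a(i) + r(i), and 1 + x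
  <= exp x makes the factors telescope to exp (c s). The start \<open>v\<close> is nonnegative, so
  a(0) = 0. Measurability of \<open>\<zeta> i\<close> and integrability of \<open>b i\<close> are
  asked only given measurability of \<open>V i\<close>, because the stopping rule makes
  \<open>\<zeta> i\<close> depend on \<open>V i\<close>; the induction supplies the premise.\<close>

lemma expectation_neg_part_cube_gronwall:
  assumes B: "brownian_motion M F T B"
    and s0: "s 0 = 0" and sn: "s n \<le> T"
    and step: "\<And>i. i < n \<Longrightarrow> s i < s (Suc i) \<and> s (Suc i) - s i \<le> h"
    and \<zeta>: "\<And>i. i < n \<Longrightarrow> V i \<in> borel_measurable (F (s i)) \<Longrightarrow> \<zeta> i \<in> borel_measurable (F (s i))"
    and C: "\<And>i \<omega>. i < n \<Longrightarrow> \<omega> \<in> space M \<Longrightarrow> \<bar>\<zeta> i \<omega>\<bar> \<le> C"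
    and R: "\<And>i \<omega>. i < n \<Longrightarrow> \<omega> \<in> space M \<Longrightarrow> \<zeta> i \<omega> \<noteq> 0 \<Longrightarrow> \<bar>V i \<omega>\<bar> \<le> R" "0 \<le> R"
    and V0: "\<And>\<omega>. V 0 \<omega> = v" "0 \<le> v"
    and VSuc: "\<And>i \<omega>. i < n \<Longrightarrow> V (Suc i) \<omega> = V i \<omega> + \<zeta> i \<omega> * (B (s (Suc i)) \<omega> - B (s i) \<omega>)"
    and b: "\<And>i \<omega>. i < n \<Longrightarrow> \<omega> \<in> space M \<Longrightarrow>
      3 * neg_part (V i \<omega>) * (\<zeta> i \<omega>)\<^sup>2 \<le> c * neg_part (V i \<omega>) ^ 3 + b i \<omega>"
    and b_int: "\<And>i. i < n \<Longrightarrow> V i \<in> borel_measurable (F (s i)) \<Longrightarrow> integrable M (b i)"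
    and b_nonneg: "\<And>i \<omega>. i < n \<Longrightarrow> \<omega> \<in> space M \<Longrightarrow> 0 \<le> b i \<omega>"
    and b_sum: "\<And>\<omega>. \<omega> \<in> space M \<Longrightarrow> (\<Sum>i<n. (s (Suc i) - s i) * b i \<omega>) \<le> E"
    and c: "0 \<le> c"
  shows "integrable M (\<lambda>\<omega>. neg_part (V n \<omega>) ^ 3) \<and> V n \<in> borel_measurable M \<and>
    expectation (\<lambda>\<omega>. neg_part (V n \<omega>) ^ 3) \<le> exp (c * s n) * (E + 2 * C ^ 3 * sqrt h * s n)"
proof -
  define \<delta> where "\<delta> = (\<lambda>i. s (Suc i) - s i)"
  define a where "a = (\<lambda>i. expectation (\<lambda>\<omega>. neg_part (V i \<omega>) ^ 3))"
  define \<kappa> where "\<kappa> = 2 * C ^ 3 * sqrt h"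
  define r where "r = (\<lambda>j. \<delta> j * (expectation (b j) + \<kappa>))"
  have s_mono: "s i \<le> s j" if "i \<le> j" "j \<le> n" for i j
    using mono_upto_if_Suc[of n s i j] step less_imp_le that by blast
  have s_range: "s i \<in> {0..T}" if "i \<le> n" for i
    using s_mono[of 0 i] s_mono[of i n] that s0 sn by auto
  have main: "V i \<in> borel_measurable (F (s i)) \<and> integrable M (\<lambda>\<omega>. neg_part (V i \<omega>) ^ 3) \<and>
      a i \<le> exp (c * s i) * (\<Sum>j<i. r j)" if "i \<le> n" for i
    using that
  proof (induction i)
    case 0
    have "neg_part v = 0"
      using V0 by (simp add: neg_part_def)
    then show ?case
      using V0(1) by (simp add: a_def measurable_cong[of _ "V 0" "\<lambda>_. v"])
  next
    case (Suc i)
    then have i: "i < n" and IH: "V i \<in> borel_measurable (F (s i))"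
        "integrable M (\<lambda>\<omega>. neg_part (V i \<omega>) ^ 3)" "a i \<le> exp (c * s i) * (\<Sum>j<i. r j)"
      by auto
    have C0: "0 \<le> C"
      using C[OF i] not_empty by (metis abs_ge_zero all_not_in_conv order_trans)
    have si: "0 \<le> s i" "s i < s (Suc i)" "s (Suc i) \<le> T"
      using s_range[of i] s_range[of "Suc i"] step[OF i] i by auto
    have \<delta>: "0 \<le> \<delta> i" "\<delta> i \<le> h"
      using step[OF i] by (auto simp: \<delta>_def)
    note st = expectation_neg_part_cube_step[OF B si IH(1) \<zeta>[OF i IH(1)] C[OF i] R(1)[OF i] R(2) IH(2)]
    have VSuc': "V (Suc i) = (\<lambda>\<omega>. V i \<omega> + \<zeta> i \<omega> * (B (s (Suc i)) \<omega> - B (s i) \<omega>))"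
      using VSuc[OF i] by auto
    have "B u \<in> borel_measurable (F u)" if "u \<in> {0..T}" for u
      using B that by (auto simp: brownian_motion_def adapted_def)
    then have "B (s i) \<in> borel_measurable (F (s (Suc i)))" "B (s (Suc i)) \<in> borel_measurable (F (s (Suc i)))"
      using measurable_filtration_mono[of "B (s i)" "s i" "s (Suc i)"] si by auto
    then have meas: "V (Suc i) \<in> borel_measurable (F (s (Suc i)))"
      unfolding VSuc' using measurable_filtration_mono[of _ "s i" "s (Suc i)"] IH(1) \<zeta>[OF i IH(1)] si
      by (intro borel_measurable_add borel_measurable_times borel_measurable_diff) auto
    have "expectation (\<lambda>\<omega>. 3 * neg_part (V i \<omega>) * (\<zeta> i \<omega>)\<^sup>2)
        \<le> expectation (\<lambda>\<omega>. c * neg_part (V i \<omega>) ^ 3 + b i \<omega>)"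
      using st(2) IH(2) b_int[OF i IH(1)] b[OF i] by (intro integral_mono) auto
    also have "\<dots> = c * a i + expectation (b i)"
      using IH(2) b_int[OF i IH(1)] by (simp add: a_def)
    finally have "\<delta> i * expectation (\<lambda>\<omega>. 3 * neg_part (V i \<omega>) * (\<zeta> i \<omega>)\<^sup>2) \<le> \<delta> i * (c * a i + expectation (b i))"
      using \<delta> by (intro mult_left_mono)
    moreover have "2 * C ^ 3 * \<delta> i * sqrt (\<delta> i) \<le> \<delta> i * \<kappa>"
      using mult_left_mono[of "sqrt (\<delta> i)" "sqrt h" "2 * C ^ 3 * \<delta> i"] \<delta> C0
      by (simp add: \<kappa>_def mult_ac)
    ultimately have "a (Suc i) \<le> (1 + c * \<delta> i) * a i + r i"
      using st(3) by (simp add: a_def VSuc' r_def \<delta>_def algebra_simps)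
    moreover have "0 \<le> a i"
      by (simp add: a_def)
    moreover have "1 + c * \<delta> i \<le> exp (c * \<delta> i)"
      using exp_ge_add_one_self[of "c * \<delta> i"] by simp
    ultimately have "a (Suc i) \<le> exp (c * \<delta> i) * a i + r i"
      using mult_right_mono[of "1 + c * \<delta> i" "exp (c * \<delta> i)" "a i"] by linarith
    also have "exp (c * \<delta> i) * a i \<le> exp (c * \<delta> i) * (exp (c * s i) * (\<Sum>j<i. r j))"
      using IH(3) by (intro mult_left_mono) auto
    also have "\<dots> = exp (c * s (Suc i)) * (\<Sum>j<i. r j)"
      by (simp add: \<delta>_def algebra_simps flip: exp_add)
    also have "r i \<le> exp (c * s (Suc i)) * r i"
    proof -
      have "0 \<le> expectation (b i)"
        using b_nonneg[OF i] by (intro integral_nonneg_AE AE_I2) auto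
      moreover have "0 \<le> \<kappa>"
        using C0 \<delta> by (auto simp: \<kappa>_def)
      ultimately have "0 \<le> r i"
        using \<delta> by (simp add: r_def)
      moreover have "1 \<le> exp (c * s (Suc i))"
        using c si by simp
      ultimately show ?thesis
        by (simp add: mult_le_cancel_right1)
    qed
    finally show ?case
      using meas st(1) by (simp add: VSuc' distrib_left)
  qed
  have "(\<Sum>j<n. \<delta> j) = s n"
    using sum_lessThan_telescope[of s n] s0 by (simp add: \<delta>_def)
  then have "(\<Sum>j<n. r j) = (\<Sum>j<n. \<delta> j * expectation (b j)) + s n * \<kappa>"
    by (simp add: r_def distrib_left sum.distrib flip: sum_distrib_right)
  \<comment> \<open>The bound \<open>E\<close> holds path by path and for the whole sum only, so the
    sum has to go back under the expectation before it can be used.\<close>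
  also have "(\<Sum>j<n. \<delta> j * expectation (b j)) = expectation (\<lambda>\<omega>. \<Sum>j<n. \<delta> j * b j \<omega>)"
    using b_int main by (subst Bochner_Integration.integral_sum) auto
  also have "\<dots> \<le> expectation (\<lambda>\<omega>. E)"
    using b_int main b_sum by (intro integral_mono Bochner_Integration.integrable_sum) (auto simp: \<delta>_def)
  finally have "(\<Sum>j<n. r j) \<le> E + \<kappa> * s n"
    by (simp add: prob_space mult.commute)
  then have "a n \<le> exp (c * s n) * (E + \<kappa> * s n)"
    using main[OF order_refl] by (meson exp_ge_zero mult_left_mono order_trans)
  then show ?thesis
    using main[OF order_refl] measurable_filtration[OF _ s_range[OF order_refl]]
    by (auto simp: a_def \<kappa>_def)
qed

subsection \<open>Simple integrands on refined grids\<close>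

text \<open>A strong solution is adapted to the augmented filtration of its driving noise. That
  filtration lies inside \<open>F\<close>, because \<open>F\<close> already contains the null sets
  and the noise is adapted to it; \<open>Y\<close> can thus enter the stopping rule.\<close>

lemma adapted_augmented_filtration:
  assumes A: "adapted (augmented_filtration M B) T A" and B: "adapted F T B"
  shows "adapted F T A"
  unfolding adapted_def
proof
  fix s assume s: "s \<in> {0..T}"
  have "path_events M B s \<union> null_sets M \<subseteq> sets (F s)"
  proof (rule Un_least)
    show "path_events M B s \<subseteq> sets (F s)"
    proof
      fix D assume "D \<in> path_events M B s"
      then obtain u E where u: "u \<in> {0..s}" "E \<in> sets borel" "D = B u -` E \<inter> space M"
        by (auto simp: path_events_def)
      then have "B u \<in> borel_measurable (F s)"
        using measurable_filtration_mono[of "B u" u s] B s by (auto simp: adapted_def)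
      from measurable_sets[OF this u(2)] show "D \<in> sets (F s)"
        using u space_filtration[OF s] by simp
    qed
    show "null_sets M \<subseteq> sets (F s)"
      using filtration_null_sets filtration_mono[of 0 s] s by auto
  qed
  then have sub: "sigma_sets (space M) (path_events M B s \<union> null_sets M) \<subseteq> sets (F s)"
    using sets.sigma_sets_subset[of _ "F s"] space_filtration[OF s] by simp
  have "path_events M B s \<union> null_sets M \<subseteq> Pow (space M)"
    using sets.sets_into_space by (auto simp: path_events_def)
  then have "sets (augmented_filtration M B s) \<subseteq> sets (F s)"
    using sub by (simp add: augmented_filtration_def)
  moreover have "space (augmented_filtration M B s) = space (F s)"
    using space_filtration[OF s] by (simp add: augmented_filtration_def space_measure_of_conv)
  moreover have "A s \<in> borel_measurable (augmented_filtration M B s)"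
    using A s by (simp add: adapted_def)
  ultimately show "A s \<in> borel_measurable (F s)"
    using measurable_mono[OF order_refl refl, of "augmented_filtration M B s" "F s" borel] by auto
qed

lemma simple_integrand_bound:
  assumes "simple_integrand M F T n \<tau> \<xi>"
  obtains C where "\<And>u \<omega>. \<omega> \<in> space M \<Longrightarrow> \<bar>simple_process n \<tau> \<xi> u \<omega>\<bar> \<le> C"
proof -
  have "\<forall>i<n. \<exists>K. \<forall>\<omega>\<in>space M. \<bar>\<xi> i \<omega>\<bar> \<le> K"
    using assms by (auto simp: simple_integrand_def)
  then obtain K where K: "\<And>i \<omega>. i < n \<Longrightarrow> \<omega> \<in> space M \<Longrightarrow> \<bar>\<xi> i \<omega>\<bar> \<le> K i"
    by metis
  show ?thesis
  proof (rule that)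
    fix u \<omega> assume \<omega>: "\<omega> \<in> space M"
    have "\<bar>simple_process n \<tau> \<xi> u \<omega>\<bar> \<le> (\<Sum>i<n. \<bar>\<xi> i \<omega> * indicator {\<tau> i<..\<tau> (Suc i)} u\<bar>)"
      unfolding simple_process_def by (rule sum_abs)
    also have "\<dots> \<le> (\<Sum>i<n. \<bar>K i\<bar>)"
      using K[OF _ \<omega>] by (intro sum_mono) (fastforce simp: abs_mult indicator_def)
    finally show "\<bar>simple_process n \<tau> \<xi> u \<omega>\<bar> \<le> (\<Sum>i<n. \<bar>K i\<bar>)" .
  qed
qed

lemma simple_integrand_grid_mono:
  assumes "simple_integrand M F T n \<tau> \<xi>" "i \<le> j" "j \<le> n"
  shows "\<tau> i \<le> \<tau> j"
  using mono_upto_if_Suc[of n \<tau> i j] assms unfolding simple_integrand_def by blast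

text \<open>On a cell (s,u] without interior jump times, every coefficient active at
  \<open>u\<close> was fixed by time \<open>s\<close>. Evaluating at the right endpoint therefore
  gives a quantity known at the left one, as independence of the increment requires.\<close>

lemma simple_process_left_measurable:
  assumes \<xi>: "simple_integrand M F T n \<tau> \<xi>"
    and s: "0 \<le> s" "s < u" "u \<le> T" and avoid: "\<And>i. i \<le> n \<Longrightarrow> \<tau> i \<le> s \<or> u \<le> \<tau> i"
  shows "simple_process n \<tau> \<xi> u \<in> borel_measurable (F s)"
  unfolding simple_process_def[abs_def]
proof (rule borel_measurable_sum)
  fix i assume "i \<in> {..<n}"
  then have i: "i < n" by simp
  show "(\<lambda>\<omega>. \<xi> i \<omega> * indicator {\<tau> i<..\<tau> (Suc i)} u) \<in> borel_measurable (F s)"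
  proof (cases "\<tau> i < u")
    case True
    then have "\<tau> i \<le> s"
      using avoid[of i] i by auto
    moreover have "0 \<le> \<tau> i"
      using simple_integrand_grid_mono[OF \<xi>, of 0 i] i \<xi> by (auto simp: simple_integrand_def)
    moreover have "\<xi> i \<in> borel_measurable (F (\<tau> i))"
      using \<xi> i by (simp add: simple_integrand_def)
    ultimately have "\<xi> i \<in> borel_measurable (F s)"
      using s by (intro measurable_filtration_mono[of "\<xi> i" "\<tau> i" s]) linarith+
    then show ?thesis
      by simp
  qed simp
qed

end

lemma simple_process_constant:
  assumes avoid: "\<And>i. i \<le> n \<Longrightarrow> \<tau> i \<le> s \<or> u \<le> \<tau> i" and v: "s < v" "v \<le> u"
  shows "simple_process n \<tau> \<xi> v \<omega> = simple_process n \<tau> \<xi> u \<omega>"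
  unfolding simple_process_def
proof (rule sum.cong[OF refl])
  fix i assume "i \<in> {..<n}"
  then show "\<xi> i \<omega> * indicator {\<tau> i<..\<tau> (Suc i)} v = \<xi> i \<omega> * indicator {\<tau> i<..\<tau> (Suc i)} u"
    using avoid[of i] avoid[of "Suc i"] v by (auto simp: indicator_def)
qed

lemma simple_integral_increment:
  assumes "\<And>i. i < n \<Longrightarrow> \<tau> i \<le> \<tau> (Suc i)"
    and avoid: "\<And>i. i \<le> n \<Longrightarrow> \<tau> i \<le> s \<or> u \<le> \<tau> i" and "s < u"
  shows "simple_integral B n \<tau> \<xi> u \<omega> =
    simple_integral B n \<tau> \<xi> s \<omega> + simple_process n \<tau> \<xi> u \<omega> * (B u \<omega> - B s \<omega>)"
  unfolding simple_integral_def simple_process_def sum_distrib_right sum.distrib[symmetric]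
proof (rule sum.cong[OF refl])
  fix i assume "i \<in> {..<n}"
  then have "\<tau> i \<le> \<tau> (Suc i)" "\<tau> i \<le> s \<or> u \<le> \<tau> i" "\<tau> (Suc i) \<le> s \<or> u \<le> \<tau> (Suc i)"
    using assms(1)[of i] avoid[of i] avoid[of "Suc i"] by auto
  with \<open>s < u\<close> show "\<xi> i \<omega> * (B (min u (\<tau> (Suc i))) \<omega> - B (min u (\<tau> i)) \<omega>) =
      \<xi> i \<omega> * (B (min s (\<tau> (Suc i))) \<omega> - B (min s (\<tau> i)) \<omega>)
      + \<xi> i \<omega> * indicator {\<tau> i<..\<tau> (Suc i)} u * (B u \<omega> - B s \<omega>)"
    by (auto simp: min_def algebra_simps)
qed

text \<open>The half-open cells are disjoint, so their indicators add up to that of the whole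
  interval and the comparison can be made cell by cell under the integral.\<close>

lemma sum_le_nn_integral_of_step:
  fixes s :: "nat \<Rightarrow> real" and c :: "nat \<Rightarrow> real" and \<psi> :: "real \<Rightarrow> ennreal"
  assumes s: "\<And>j. j < n \<Longrightarrow> s j \<le> s (Suc j)" and c: "\<And>j. j < n \<Longrightarrow> 0 \<le> c j"
    and \<psi>: "\<And>j u. j < n \<Longrightarrow> s j < u \<Longrightarrow> u \<le> s (Suc j) \<Longrightarrow> ennreal (c j) \<le> \<psi> u"
  shows "ennreal (\<Sum>j<n. (s (Suc j) - s j) * c j) \<le> (\<integral>\<^sup>+u\<in>{s 0..s n}. \<psi> u \<partial>lborel)"
proof -
  have disjoint: "(\<Sum>j<m. indicator {s j<..s (Suc j)} u :: ennreal) = indicator {s 0<..s m} u"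
    if "m \<le> n" for m u
    using that
  proof (induction m)
    case (Suc m)
    have "s 0 \<le> s m"
      using mono_upto_if_Suc[of n s 0 m] s Suc.prems by simp
    with Suc s[of m] show ?case
      by (auto simp: indicator_def)
  qed simp
  have "ennreal (\<Sum>j<n. (s (Suc j) - s j) * c j) = (\<Sum>j<n. ennreal (c j) * emeasure lborel {s j<..s (Suc j)})"
  proof -
    have "ennreal (\<Sum>j<n. (s (Suc j) - s j) * c j) = (\<Sum>j<n. ennreal ((s (Suc j) - s j) * c j))"
      using s c by (intro sum_ennreal[symmetric]) simp
    also have "\<dots> = (\<Sum>j<n. ennreal (c j) * emeasure lborel {s j<..s (Suc j)})"
      using s c by (intro sum.cong refl) (simp add: ennreal_mult mult.commute)
    finally show ?thesis .
  qed
  also have "\<dots> = (\<integral>\<^sup>+u. (\<Sum>j<n. ennreal (c j) * indicator {s j<..s (Suc j)} u) \<partial>lborel)"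
    by (subst nn_integral_sum) (auto simp: nn_integral_cmult_indicator)
  also have "\<dots> \<le> (\<integral>\<^sup>+u\<in>{s 0..s n}. \<psi> u \<partial>lborel)"
  proof (rule nn_integral_mono)
    fix u
    have "(\<Sum>j<n. ennreal (c j) * indicator {s j<..s (Suc j)} u) \<le> (\<Sum>j<n. \<psi> u * indicator {s j<..s (Suc j)} u)"
      using \<psi> by (intro sum_mono) (auto simp: indicator_def)
    also have "\<dots> = \<psi> u * indicator {s 0<..s n} u"
      using disjoint[of n u] by (simp flip: sum_distrib_left)
    also have "\<dots> \<le> \<psi> u * indicator {s 0..s n} u"
      by (auto simp: indicator_def)
    finally show "(\<Sum>j<n. ennreal (c j) * indicator {s j<..s (Suc j)} u) \<le> \<psi> u * indicator {s 0..s n} u" .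
  qed
  finally show ?thesis .
qed

text \<open>Dominated convergence for indicators. It trades a mesh that depends on the path for one
  mesh that works with high probability.\<close>

lemma (in prob_space) AE_eventually_imp_prob_tendsto_0:
  fixes A :: "nat \<Rightarrow> 'a set"
  assumes [measurable]: "\<And>m. A m \<in> sets M"
    and "AE \<omega> in M. eventually (\<lambda>m. \<omega> \<notin> A m) sequentially"
  shows "(\<lambda>m. prob (A m)) \<longlonglongrightarrow> 0"
proof -
  have "(\<lambda>m. expectation (indicator (A m))) \<longlonglongrightarrow> expectation (\<lambda>_. 0 :: real)"
  proof (rule integral_dominated_convergence[where w = "\<lambda>_. 1"])
    show "AE \<omega> in M. (\<lambda>m. indicator (A m) \<omega>) \<longlonglongrightarrow> (0 :: real)"
      using assms(2)
    proof eventually_elim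
      case (elim \<omega>)
      then show ?case
        by (intro tendsto_eventually) (auto elim: eventually_mono)
    qed
  qed (auto simp: indicator_def)
  then show ?thesis by simp
qed

subsection \<open>Nonnegativity of the price process\<close>

text \<open>All counted terms sit at or below the last index satisfying \<open>P\<close>, whose
  partial sum includes its own term. Hence there is no overshoot.\<close>

lemma sum_until_exceeding_le:
  fixes a :: "nat \<Rightarrow> real"
  assumes "\<And>i. i < n \<Longrightarrow> 0 \<le> a i" "0 \<le> \<epsilon>" "\<And>i. i < n \<Longrightarrow> P i \<Longrightarrow> (\<Sum>l\<le>i. a l) \<le> \<epsilon>"
  shows "(\<Sum>i<n. if P i then a i else 0) \<le> \<epsilon>"
  using assms
proof (induction n)
  case (Suc n)
  show ?case
  proof (cases "P n")
    case True
    have "(\<Sum>i<Suc n. if P i then a i else 0) \<le> (\<Sum>i<Suc n. a i)"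
      using Suc.prems(1) by (intro sum_mono) auto
    also have "\<dots> \<le> \<epsilon>"
      using Suc.prems(3)[of n] True by (simp add: lessThan_Suc_atMost)
    finally show ?thesis .
  qed (use Suc in auto)
qed simp

context linear_stochastic_volatility_model
begin

lemma Y_adapted: "adapted F T Y"
proof (rule adapted_augmented_filtration)
  show "adapted (augmented_filtration M Z) T Y"
    using Y_solution by (simp add: unique_strong_solution_def strong_solution_def ito_process_def)
  show "adapted F T Z"
    using Z_brownian by (simp add: brownian_motion_def)
qed

lemma X_adapted: "adapted F T X"
  using X_equation by (simp add: ito_process_def)

text \<open>Freezing the approximating simple integral \<open>V\<close> while it is far from \<open>X\<close>, while \<open>X\<close> or \<open>Y\<close> is
  large, or once the simple integrand has accumulated an error, makes
  \<open>\<zeta>\<^sup>2 f''(V) \<lesssim> Y\<^sup>2 V\<^sup>2 f''(V) = 6 Y\<^sup>2 f(V)\<close> with \<open>f(v) = (v\<^sup>-)\<^sup>3\<close>, which is what Gronwall needs.\<close>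

lemma stopped_approximation:
  fixes s :: "nat \<Rightarrow> real" and \<zeta> :: "nat \<Rightarrow> 'a \<Rightarrow> real"
  assumes s0: "s 0 = 0" and sn: "s n = t" and t: "t \<le> T"
    and step: "\<And>i. i < n \<Longrightarrow> s i < s (Suc i) \<and> s (Suc i) - s i \<le> h"
    and \<zeta>: "\<And>i. i < n \<Longrightarrow> \<zeta> i \<in> borel_measurable (F (s i))"
    and C: "\<And>i \<omega>. i < n \<Longrightarrow> \<omega> \<in> space M \<Longrightarrow> \<bar>\<zeta> i \<omega>\<bar> \<le> C"
    and K: "0 \<le> K" and \<epsilon>: "0 < \<epsilon>" "\<epsilon> \<le> 1"
  obtains V where "V \<in> borel_measurable M" "integrable M (\<lambda>\<omega>. neg_part (V \<omega>) ^ 3)"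
    "expectation (\<lambda>\<omega>. neg_part (V \<omega>) ^ 3) \<le>
       exp (12 * K\<^sup>2 * t) * ((6 + 12 * K\<^sup>2 * t) * (K + 1) * \<epsilon> + 2 * C ^ 3 * sqrt h * t)"
    "\<And>\<omega> S. \<lbrakk>S 0 = x0; \<And>i. i < n \<Longrightarrow> S (Suc i) = S i + \<zeta> i \<omega> * (W (s (Suc i)) \<omega> - W (s i) \<omega>);
        \<And>i. i < n \<Longrightarrow> \<bar>S i - X (s i) \<omega>\<bar> \<le> \<epsilon> \<and> \<bar>X (s i) \<omega>\<bar> \<le> K \<and> \<bar>Y (s i) \<omega>\<bar> \<le> K;
        (\<Sum>l<n. (s (Suc l) - s l) * (\<zeta> l \<omega> - Y (s l) \<omega> * X (s l) \<omega>)\<^sup>2) \<le> \<epsilon>\<rbrakk> \<Longrightarrow> V \<omega> = S n"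
proof -
  define \<delta> where "\<delta> = (\<lambda>i. s (Suc i) - s i)"
  define q where "q = (\<lambda>i \<omega>. (\<zeta> i \<omega> - Y (s i) \<omega> * X (s i) \<omega>)\<^sup>2)"
  \<comment> \<open>The accumulated error runs up to and including index \<open>i\<close>: its last
    term is already known at time \<open>s i\<close>, so the rule can refuse a step before the error
    exceeds \<epsilon>.\<close>
  define good where "good = (\<lambda>i v \<omega>. \<bar>v - X (s i) \<omega>\<bar> \<le> \<epsilon> \<and> \<bar>X (s i) \<omega>\<bar> \<le> K \<and> \<bar>Y (s i) \<omega>\<bar> \<le> K \<and>
    (\<Sum>l\<le>i. \<delta> l * q l \<omega>) \<le> \<epsilon>)"
  define V where "V = rec_nat (\<lambda>_. x0)
    (\<lambda>i v \<omega>. v \<omega> + (if good i (v \<omega>) \<omega> then \<zeta> i \<omega> else 0) * (W (s (Suc i)) \<omega> - W (s i) \<omega>))"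
  define \<xi> where "\<xi> = (\<lambda>i \<omega>. if good i (V i \<omega>) \<omega> then \<zeta> i \<omega> else 0)"
  \<comment> \<open>What remains of 3 p \<zeta>^2 beyond 12 K^2 p^3, for p the negative part of
    \<open>V\<close>, after estimating p by K + 1.\<close>
  define b where "b = (\<lambda>i \<omega>. if good i (V i \<omega>) \<omega> then 6 * (K + 1) * q i \<omega> + 12 * K\<^sup>2 * (K + 1) * \<epsilon> else 0)"
  have V0: "V 0 \<omega> = x0" for \<omega>
    by (simp add: V_def)
  have VSuc: "V (Suc i) \<omega> = V i \<omega> + \<xi> i \<omega> * (W (s (Suc i)) \<omega> - W (s i) \<omega>)" for i \<omega>
    by (simp add: V_def \<xi>_def)
  have s_mono: "s i \<le> s j" if "i \<le> j" "j \<le> n" for i j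
    using mono_upto_if_Suc[of n s i j] step less_imp_le that by blast
  have s_range: "s i \<in> {0..T}" if "i \<le> n" for i
    using s_mono[of 0 i] s_mono[of i n] that s0 sn t by auto
  have t0: "0 \<le> t"
    using s_mono[of 0 n] s0 sn by simp
  have \<delta>: "0 < \<delta> i" if "i < n" for i
    using step[OF that] by (simp add: \<delta>_def)
  have q0: "0 \<le> q i \<omega>" for i \<omega>
    by (simp add: q_def)
  have \<delta>q: "0 \<le> \<delta> i * q i \<omega>" if "i < n" for i \<omega>
    using \<delta>[OF that] q0[of i \<omega>] by simp
  have meas: "\<zeta> l \<in> borel_measurable (F (s i))" "X (s l) \<in> borel_measurable (F (s i))"
      "Y (s l) \<in> borel_measurable (F (s i))" if "l \<le> i" "i < n" for l i
  proof -
    have "0 \<le> s l" "s l \<le> s i" "s i \<le> T" "l < n" "s l \<in> {0..T}"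
      using that s_range[of l] s_range[of i] s_mono[of l i] by auto
    then show "\<zeta> l \<in> borel_measurable (F (s i))" "X (s l) \<in> borel_measurable (F (s i))"
      "Y (s l) \<in> borel_measurable (F (s i))"
      using \<zeta>[of l] X_adapted Y_adapted unfolding adapted_def
      by (blast intro: measurable_filtration_mono)+
  qed
  have good_meas: "Measurable.pred (F (s i)) (\<lambda>\<omega>. good i (V i \<omega>) \<omega>)"
    if "i < n" and V [measurable]: "V i \<in> borel_measurable (F (s i))" for i
  proof -
    have "(\<lambda>\<omega>. \<Sum>l\<le>i. \<delta> l * q l \<omega>) \<in> borel_measurable (F (s i))"
      unfolding q_def using meas[OF _ \<open>i < n\<close>]
      by (intro borel_measurable_sum borel_measurable_times borel_measurable_power
          borel_measurable_diff borel_measurable_const) auto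
    note [measurable] = this meas(2,3)[OF order_refl \<open>i < n\<close>]
    show ?thesis
      unfolding good_def by measurable
  qed
  have V_le: "\<bar>V i \<omega>\<bar> \<le> K + 1" if "good i (V i \<omega>) \<omega>" for i \<omega>
    using that \<epsilon> by (auto simp: good_def)
  have main: "integrable M (\<lambda>\<omega>. neg_part (V n \<omega>) ^ 3) \<and> V n \<in> borel_measurable M \<and>
    expectation (\<lambda>\<omega>. neg_part (V n \<omega>) ^ 3) \<le>
      exp (12 * K\<^sup>2 * s n) * ((6 + 12 * K\<^sup>2 * t) * (K + 1) * \<epsilon> + 2 * C ^ 3 * sqrt h * s n)"
  proof (rule expectation_neg_part_cube_gronwall[where B = W and s = s and V = V and \<zeta> = \<xi>
        and b = b and R = "K + 1" and v = x0])
    show "brownian_motion M F T W" "s 0 = 0"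
      by (fact W_brownian s0)+
    show "s n \<le> T"
      using sn t by simp
    show "s i < s (Suc i) \<and> s (Suc i) - s i \<le> h" if "i < n" for i
      by (rule step[OF that])
    show "\<xi> i \<in> borel_measurable (F (s i))" if i: "i < n" and "V i \<in> borel_measurable (F (s i))" for i
    proof -
      note [measurable] = good_meas[OF that] \<zeta>[OF i]
      show ?thesis
        unfolding \<xi>_def by measurable
    qed
    show "\<bar>\<xi> i \<omega>\<bar> \<le> C" if "i < n" "\<omega> \<in> space M" for i \<omega>
      using C[OF that] by (auto simp: \<xi>_def)
    show "\<bar>V i \<omega>\<bar> \<le> K + 1" if "i < n" "\<omega> \<in> space M" "\<xi> i \<omega> \<noteq> 0" for i \<omega>
      using V_le[of i \<omega>] that by (auto simp: \<xi>_def split: if_splits)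
    show "3 * neg_part (V i \<omega>) * (\<xi> i \<omega>)\<^sup>2 \<le> 12 * K\<^sup>2 * neg_part (V i \<omega>) ^ 3 + b i \<omega>"
      if "i < n" "\<omega> \<in> space M" for i \<omega>
    proof (cases "good i (V i \<omega>) \<omega>")
      case True
      define p v x y z where "p = neg_part (V i \<omega>)" "v = V i \<omega>" "x = X (s i) \<omega>" "y = Y (s i) \<omega>" "z = \<zeta> i \<omega>"
      note defs = this
      have p: "0 \<le> p" "p \<le> K + 1"
        using V_le[OF True] neg_part_le_abs[of "V i \<omega>"] by (auto simp: defs)
      have xy: "\<bar>v - x\<bar> \<le> \<epsilon>" "\<bar>x\<bar> \<le> K" "\<bar>y\<bar> \<le> K"
        using True by (auto simp: defs good_def)
      \<comment> \<open>The inequality (a + b)^2 <= 2 a^2 + 2 b^2 is used twice, to pass from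
        \<open>z\<close> to \<open>y * x\<close> and from \<open>x\<close> to \<open>v\<close>. This
        costs a factor 4 and explains 12 K^2 in place of the formal 3 K^2.\<close>
      have z: "z\<^sup>2 \<le> 2 * (z - y * x)\<^sup>2 + 2 * (y * x)\<^sup>2"
        using zero_le_power2[of "z - 2 * (y * x)"] by (simp add: power2_eq_square algebra_simps)
      have yx: "(y * x)\<^sup>2 \<le> K\<^sup>2 * x\<^sup>2"
        using xy power_mono[OF xy(3), of 2] by (simp add: power_mult_distrib mult_right_mono)
      have x: "x\<^sup>2 \<le> 2 * v\<^sup>2 + 2 * (v - x)\<^sup>2"
        using zero_le_power2[of "x - 2 * v"] by (simp add: power2_eq_square algebra_simps)
      have vx: "(v - x)\<^sup>2 \<le> \<epsilon>"
      proof -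
        have "(v - x)\<^sup>2 \<le> \<epsilon>\<^sup>2"
          using power_mono[OF xy(1), of 2] by simp
        also have "\<dots> \<le> \<epsilon>"
          using \<epsilon> by (simp add: power2_eq_square mult_left_le)
        finally show ?thesis .
      qed
      have "K\<^sup>2 * x\<^sup>2 \<le> K\<^sup>2 * (2 * v\<^sup>2 + 2 * \<epsilon>)"
        using x vx by (intro mult_left_mono) auto
      with z yx have "z\<^sup>2 \<le> 2 * (z - y * x)\<^sup>2 + 4 * K\<^sup>2 * v\<^sup>2 + 4 * K\<^sup>2 * \<epsilon>"
        by (simp add: algebra_simps)
      then have "3 * p * z\<^sup>2 \<le> 3 * p * (2 * (z - y * x)\<^sup>2 + 4 * K\<^sup>2 * v\<^sup>2 + 4 * K\<^sup>2 * \<epsilon>)"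
        using p by (intro mult_left_mono) auto
      also have "\<dots> = 12 * K\<^sup>2 * (p * v\<^sup>2) + p * (6 * (z - y * x)\<^sup>2 + 12 * K\<^sup>2 * \<epsilon>)"
        by (simp add: algebra_simps)
      also have "p * v\<^sup>2 = p ^ 3"
        by (simp add: defs neg_part_mult_square)
      also have "p * (6 * (z - y * x)\<^sup>2 + 12 * K\<^sup>2 * \<epsilon>) \<le> (K + 1) * (6 * (z - y * x)\<^sup>2 + 12 * K\<^sup>2 * \<epsilon>)"
        using p \<epsilon> by (intro mult_right_mono) auto
      finally show ?thesis
        using True by (simp add: \<xi>_def b_def q_def defs algebra_simps)
    qed (use K in \<open>simp add: \<xi>_def b_def\<close>)
    show b_nonneg: "0 \<le> b i \<omega>" for i \<omega>
      using K \<epsilon> q0[of i \<omega>] by (auto simp: b_def)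
    show "integrable M (b i)" if i: "i < n" and V: "V i \<in> borel_measurable (F (s i))" for i
    proof (rule integrable_const_bound)
      note [measurable] = good_meas[OF that] \<zeta>[OF i] meas[OF order_refl i]
      have "b i \<in> borel_measurable (F (s i))"
        unfolding b_def q_def by measurable
      then show "b i \<in> borel_measurable M"
        using measurable_filtration s_range[of i] i by simp
      \<comment> \<open>This bound degenerates as the mesh shrinks, but it serves integrability
        only; the quantitative estimate is the one on the weighted sum of the
        \<open>b i\<close>.\<close>
      show "AE \<omega> in M. norm (b i \<omega>) \<le> 6 * (K + 1) * (\<epsilon> / \<delta> i) + 12 * K\<^sup>2 * (K + 1) * \<epsilon>"
      proof (rule AE_I2)
        fix \<omega>
        have "q i \<omega> \<le> \<epsilon> / \<delta> i" if "good i (V i \<omega>) \<omega>"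
        proof -
          have "\<delta> i * q i \<omega> \<le> (\<Sum>l\<le>i. \<delta> l * q l \<omega>)"
            using \<delta>q i by (intro member_le_sum) auto
          also have "\<dots> \<le> \<epsilon>"
            using that by (simp add: good_def)
          finally show ?thesis
            using \<delta>[OF i] by (simp add: field_simps)
        qed
        then have "6 * (K + 1) * q i \<omega> \<le> 6 * (K + 1) * (\<epsilon> / \<delta> i)" if "good i (V i \<omega>) \<omega>"
          using K that by (intro mult_left_mono) auto
        then have "b i \<omega> \<le> 6 * (K + 1) * (\<epsilon> / \<delta> i) + 12 * K\<^sup>2 * (K + 1) * \<epsilon>"
          unfolding b_def using K \<epsilon> \<delta>[OF i] by auto
        then show "norm (b i \<omega>) \<le> 6 * (K + 1) * (\<epsilon> / \<delta> i) + 12 * K\<^sup>2 * (K + 1) * \<epsilon>"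
          using b_nonneg[of i \<omega>] by simp
      qed
    qed
    show "(\<Sum>i<n. (s (Suc i) - s i) * b i \<omega>) \<le> (6 + 12 * K\<^sup>2 * t) * (K + 1) * \<epsilon>" for \<omega>
    proof -
      have "(\<Sum>i<n. \<delta> i * b i \<omega>) \<le>
          (\<Sum>i<n. 6 * (K + 1) * (if good i (V i \<omega>) \<omega> then \<delta> i * q i \<omega> else 0) + \<delta> i * (12 * K\<^sup>2 * (K + 1) * \<epsilon>))"
        using \<delta> K \<epsilon> by (intro sum_mono) (auto simp: b_def algebra_simps less_imp_le)
      also have "\<dots> = 6 * (K + 1) * (\<Sum>i<n. if good i (V i \<omega>) \<omega> then \<delta> i * q i \<omega> else 0)
          + (\<Sum>i<n. \<delta> i) * (12 * K\<^sup>2 * (K + 1) * \<epsilon>)"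
        by (simp add: sum.distrib sum_distrib_left sum_distrib_right)
      also have "(\<Sum>i<n. \<delta> i) = t"
        using sum_lessThan_telescope[of s n] s0 sn by (simp add: \<delta>_def)
      also have "6 * (K + 1) * (\<Sum>i<n. if good i (V i \<omega>) \<omega> then \<delta> i * q i \<omega> else 0) \<le> 6 * (K + 1) * \<epsilon>"
        using \<delta>q \<epsilon> K by (intro mult_left_mono sum_until_exceeding_le) (auto simp: good_def)
      finally have "(\<Sum>i<n. \<delta> i * b i \<omega>) \<le> 6 * (K + 1) * \<epsilon> + t * (12 * K\<^sup>2 * (K + 1) * \<epsilon>)"
        by simp
      also have "\<dots> = (6 + 12 * K\<^sup>2 * t) * (K + 1) * \<epsilon>"
        by (simp add: algebra_simps)
      finally show ?thesis
        by (simp add: \<delta>_def)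
    qed
    show "V 0 \<omega> = x0" for \<omega>
      by (rule V0)
    show "0 \<le> 12 * K\<^sup>2" "0 \<le> x0" "0 \<le> K + 1"
      using K initial_pos by auto
    show "V (Suc i) \<omega> = V i \<omega> + \<xi> i \<omega> * (W (s (Suc i)) \<omega> - W (s i) \<omega>)" for i \<omega>
      by (rule VSuc)
  qed
  show ?thesis
  proof (rule that[of "V n"])
    fix \<omega> and S :: "nat \<Rightarrow> real"
    assume S: "S 0 = x0" "\<And>i. i < n \<Longrightarrow> S (Suc i) = S i + \<zeta> i \<omega> * (W (s (Suc i)) \<omega> - W (s i) \<omega>)"
      and near: "\<And>i. i < n \<Longrightarrow> \<bar>S i - X (s i) \<omega>\<bar> \<le> \<epsilon> \<and> \<bar>X (s i) \<omega>\<bar> \<le> K \<and> \<bar>Y (s i) \<omega>\<bar> \<le> K"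
      and err: "(\<Sum>l<n. (s (Suc l) - s l) * (\<zeta> l \<omega> - Y (s l) \<omega> * X (s l) \<omega>)\<^sup>2) \<le> \<epsilon>"
    \<comment> \<open>As long as \<open>V\<close> agrees with \<open>S\<close>, the assumptions on
      \<open>S\<close> keep \<open>good\<close> satisfied, so no step is refused and the agreement
      persists.\<close>
    have "V i \<omega> = S i" if "i \<le> n" for i
      using that
    proof (induction i)
      case (Suc i)
      have "(\<Sum>l\<le>i. \<delta> l * q l \<omega>) \<le> (\<Sum>l<n. \<delta> l * q l \<omega>)"
        using Suc.prems \<delta>q by (intro sum_mono2) auto
      then have "good i (V i \<omega>) \<omega>"
        using near[of i] err Suc by (simp add: good_def \<delta>_def q_def)
      then show ?case
        using Suc S(2)[of i] by (simp add: VSuc \<xi>_def)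
    qed (simp add: V0 S)
    then show "V n \<omega> = S n"
      by simp
  qed (use main sn in auto)
qed

end

text \<open>On a cell, p at the right endpoint equals p u for every u inside, and H at the left
  endpoint differs from H u by at most \<theta>. Splitting the square accordingly bounds the grid
  error by twice the L2 error plus an oscillation term.\<close>

lemma riemann_sum_error_le:
  fixes p H :: "real \<Rightarrow> real" and s :: "nat \<Rightarrow> real"
  assumes [measurable]: "p \<in> borel_measurable borel" and H: "continuous_on {0..T} H"
    and s: "0 \<le> s 0" "s n \<le> T" "\<And>j. j < n \<Longrightarrow> s j \<le> s (Suc j)"
    and p: "\<And>j u. j < n \<Longrightarrow> s j < u \<Longrightarrow> u \<le> s (Suc j) \<Longrightarrow> p u = p (s (Suc j))"
    and \<theta>: "\<And>j u. j < n \<Longrightarrow> s j < u \<Longrightarrow> u \<le> s (Suc j) \<Longrightarrow> \<bar>H u - H (s j)\<bar> \<le> \<theta>"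
    and T: "0 \<le> T"
  shows "ennreal (\<Sum>j<n. (s (Suc j) - s j) * (p (s (Suc j)) - H (s j))\<^sup>2) \<le>
    2 * (\<integral>\<^sup>+u\<in>{0..T}. ennreal ((p u - H u)\<^sup>2) \<partial>lborel) + ennreal (2 * \<theta>\<^sup>2 * T)"
proof -
  \<comment> \<open>\<open>H\<close> is controlled on {0..T} only, so it is cut off there before it
    enters measurable integrands.\<close>
  have [measurable]: "(\<lambda>u. indicator {0..T} u * H u) \<in> borel_measurable borel"
    using borel_measurable_continuous_on_indicator[OF _ H] by simp
  have eq: "(\<integral>\<^sup>+u\<in>{0..T}. ennreal ((p u - H u)\<^sup>2) \<partial>lborel) =
      (\<integral>\<^sup>+u\<in>{0..T}. ennreal ((p u - indicator {0..T} u * H u)\<^sup>2) \<partial>lborel)"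
    by (intro nn_integral_cong) (auto simp: indicator_def)
  have "ennreal (\<Sum>j<n. (s (Suc j) - s j) * (p (s (Suc j)) - H (s j))\<^sup>2) \<le>
      (\<integral>\<^sup>+u\<in>{s 0..s n}. (2 * ennreal ((p u - H u)\<^sup>2) + ennreal (2 * \<theta>\<^sup>2)) \<partial>lborel)"
  proof (rule sum_le_nn_integral_of_step)
    fix j u assume ju: "j < n" "s j < u" "u \<le> s (Suc j)"
    have "(p (s (Suc j)) - H (s j))\<^sup>2 = ((p u - H u) + (H u - H (s j)))\<^sup>2"
      using p[OF ju] by simp
    also have "\<dots> \<le> 2 * (p u - H u)\<^sup>2 + 2 * (H u - H (s j))\<^sup>2"
      using zero_le_power2[of "(p u - H u) - (H u - H (s j))"] by (simp add: power2_eq_square algebra_simps)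
    also have "(H u - H (s j))\<^sup>2 \<le> \<theta>\<^sup>2"
      using power_mono[OF \<theta>[OF ju], of 2] by simp
    finally have "(p (s (Suc j)) - H (s j))\<^sup>2 \<le> 2 * (p u - H u)\<^sup>2 + 2 * \<theta>\<^sup>2"
      by simp
    then have "ennreal ((p (s (Suc j)) - H (s j))\<^sup>2) \<le> ennreal (2 * (p u - H u)\<^sup>2 + 2 * \<theta>\<^sup>2)"
      by (rule ennreal_leI)
    also have "\<dots> = 2 * ennreal ((p u - H u)\<^sup>2) + ennreal (2 * \<theta>\<^sup>2)"
      by (simp add: ennreal_plus ennreal_mult)
    finally show "ennreal ((p (s (Suc j)) - H (s j))\<^sup>2) \<le> 2 * ennreal ((p u - H u)\<^sup>2) + ennreal (2 * \<theta>\<^sup>2)" .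
  qed (use s in auto)
  also have "\<dots> \<le> (\<integral>\<^sup>+u. (2 * (ennreal ((p u - indicator {0..T} u * H u)\<^sup>2) * indicator {0..T} u)
      + ennreal (2 * \<theta>\<^sup>2) * indicator {0..T} u) \<partial>lborel)"
    using s by (intro nn_integral_mono) (auto simp: indicator_def)
  also have "\<dots> = 2 * (\<integral>\<^sup>+u\<in>{0..T}. ennreal ((p u - indicator {0..T} u * H u)\<^sup>2) \<partial>lborel)
      + ennreal (2 * \<theta>\<^sup>2) * emeasure lborel {0..T}"
    by (subst nn_integral_add) (auto simp: nn_integral_cmult nn_integral_cmult_indicator)
  also have "ennreal (2 * \<theta>\<^sup>2) * emeasure lborel {0..T} = ennreal (2 * \<theta>\<^sup>2 * T)"
    using T by (simp add: ennreal_mult)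
  finally show ?thesis
    by (simp add: eq)
qed

lemma borel_measurable_simple_process_time:
  "(\<lambda>u. simple_process n \<tau> \<xi> u \<omega>) \<in> borel_measurable borel"
  unfolding simple_process_def by measurable

text \<open>Under the product law the inner integral over \<open>A\<close> at a fixed value x >= 0
  of \<open>B\<close> is the mean excess of an exponential variable over x, namely exp (-l x) / l by
  memorylessness. Tonelli's theorem then integrates this over the law of \<open>B\<close>.\<close>

lemma (in prob_space) nn_integral_indep_exponential:
  assumes indep: "indep_var borel A borel B"
    and A: "distributed M lborel A (exponential_density l)" and l: "0 < l"
    and B: "AE \<omega> in M. 0 \<le> B \<omega>"
  shows "(\<integral>\<^sup>+\<omega>. ennreal (max (A \<omega> - B \<omega>) 0) \<partial>M) = (\<integral>\<^sup>+\<omega>. ennreal (exp (- l * B \<omega>) / l) \<partial>M)"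
proof -
  have A_meas [measurable]: "A \<in> borel_measurable M" and B_meas [measurable]: "B \<in> borel_measurable M"
    using indep_var_rv1[OF indep] indep_var_rv2[OF indep] by auto
  have tail: "(\<integral>\<^sup>+r. ennreal (max (r - x) 0) \<partial>distr M borel A) = ennreal (exp (- l * x) / l)"
    if "0 \<le> x" for x
  proof -
    have "(\<integral>\<^sup>+r. ennreal (max (r - x) 0) \<partial>distr M borel A) = (\<integral>\<^sup>+\<omega>. ennreal (max (A \<omega> - x) 0) \<partial>M)"
      by (subst nn_integral_distr) auto
    also have "\<dots> = (\<integral>\<^sup>+r. ennreal (exponential_density l r) * ennreal (max (r - x) 0) \<partial>lborel)"
      by (subst distributed_nn_integral[OF A]) auto
    also have "\<dots> = (\<integral>\<^sup>+w. ennreal (exponential_density l (x + w)) * ennreal (max w 0) \<partial>lborel)"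
      by (subst nn_integral_real_affine[where c = 1 and t = x]) auto
    \<comment> \<open>For w >= 0 the shift by x >= 0 multiplies the density by exp (-l x); for w < 0
      both integrands vanish. What is left is the first moment of the exponential law.\<close>
    also have "\<dots> = (\<integral>\<^sup>+w. ennreal (exp (- l * x)) * ennreal (exponential_density l w * w ^ 1) \<partial>lborel)"
      using l that by (intro nn_integral_cong)
        (auto simp: exponential_density_def max_def ring_distribs simp flip: ennreal_mult exp_add)
    also have "\<dots> = ennreal (exp (- l * x)) * ennreal (1 / l)"
      using nn_integral_erlang_ith_moment[OF l, of 0 1] by (subst nn_integral_cmult) auto
    also have "\<dots> = ennreal (exp (- l * x) / l)"
      using l by (simp flip: ennreal_mult)
    finally show ?thesis .
  qed
  interpret A': prob_space "distr M borel A" by (rule prob_space_distr) fact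
  interpret B': prob_space "distr M borel B" by (rule prob_space_distr) fact
  interpret P: pair_sigma_finite "distr M borel A" "distr M borel B" ..
  have "(\<integral>\<^sup>+\<omega>. ennreal (max (A \<omega> - B \<omega>) 0) \<partial>M) =
      (\<integral>\<^sup>+z. ennreal (max (fst z - snd z) 0) \<partial>distr M (borel \<Otimes>\<^sub>M borel) (\<lambda>\<omega>. (A \<omega>, B \<omega>)))"
    by (subst nn_integral_distr) auto
  also have "distr M (borel \<Otimes>\<^sub>M borel) (\<lambda>\<omega>. (A \<omega>, B \<omega>)) = distr M borel A \<Otimes>\<^sub>M distr M borel B"
    using indep by (simp add: indep_var_distribution_eq)
  also have "(\<integral>\<^sup>+z. ennreal (max (fst z - snd z) 0) \<partial>(distr M borel A \<Otimes>\<^sub>M distr M borel B)) =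
      (\<integral>\<^sup>+x. \<integral>\<^sup>+r. ennreal (max (r - x) 0) \<partial>distr M borel A \<partial>distr M borel B)"
    by (subst P.nn_integral_snd[symmetric]) auto
  also have "\<dots> = (\<integral>\<^sup>+\<omega>. (\<integral>\<^sup>+r. ennreal (max (r - B \<omega>) 0) \<partial>distr M borel A) \<partial>M)"
    by (subst nn_integral_distr) auto
  also have "\<dots> = (\<integral>\<^sup>+\<omega>. ennreal (exp (- l * B \<omega>) / l) \<partial>M)"
    by (rule nn_integral_cong_AE, rule eventually_mono[OF B], rule tail)
  finally show ?thesis .
qed

section \<open>From stopped simple integrals to the sign of the price\<close>

context linear_stochastic_volatility_model
begin

lemma X_integral_equation:
  obtains I where "ito_integral M F T W (\<lambda>t \<omega>. Y t \<omega> * X t \<omega>) I"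
    "AE \<omega> in M. \<forall>u\<in>{0..T}. X u \<omega> = x0 + I u \<omega>"
  using X_equation unfolding ito_process_def by (auto simp: set_lebesgue_integral_def)

text \<open>Four sources of failure receive a share \<eta>/4 each: the L2 error of the integrand,
  the uniform error of the integral, a grid that is too coarse, and a large negative part of the
  stopped integral. The bound \<open>K\<close> stays a condition on the path, to be removed
  afterwards by continuity.\<close>

lemma X_ge_outside_small_event:
  assumes t: "t \<in> {0..T}" and K: "0 \<le> K" and a: "0 < a" and \<eta>: "0 < \<eta>"
  obtains N where "N \<in> sets M" "prob N \<le> \<eta>"
    "AE \<omega> in M. \<omega> \<notin> N \<longrightarrow> (\<forall>u\<in>{0..T}. \<bar>X u \<omega>\<bar> \<le> K \<and> \<bar>Y u \<omega>\<bar> \<le> K) \<longrightarrow> - a \<le> X t \<omega>"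
proof -
  \<comment> \<open>\<open>c\<close> is the Markov threshold for a negative part of size a/2; the
    other half of a absorbs the distance from the integral to X, whence \<epsilon> <= a/2.
    \<open>G * \<epsilon>\<close> is the mesh-independent part of the Gronwall bound. It gets c
    \<eta>/8, as does the mesh term, so dividing by c leaves \<eta>/4.\<close>
  define c G \<epsilon> where "c = (a / 2) ^ 3"
    and "G = exp (12 * K\<^sup>2 * t) * ((6 + 12 * K\<^sup>2 * t) * (K + 1))"
    and "\<epsilon> = min (min 1 (a / 2)) (c * \<eta> / (8 * G))"
  have c: "0 < c"
    using a by (simp add: c_def)
  have G: "0 < G"
  proof -
    have "0 < 6 + 12 * K\<^sup>2 * t" "0 < K + 1"
      using K t by (auto intro: add_pos_nonneg)
    then show ?thesis
      by (simp add: G_def)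
  qed
  have \<epsilon>: "0 < \<epsilon>" "\<epsilon> \<le> 1" "\<epsilon> \<le> a / 2"
    using a c \<eta> G by (auto simp: \<epsilon>_def)
  have "\<epsilon> \<le> c * \<eta> / (8 * G)"
    by (simp add: \<epsilon>_def)
  then have G\<epsilon>: "G * \<epsilon> \<le> c * \<eta> / 8"
    using G by (simp add: field_simps)
  obtain I where I: "ito_integral M F T W (\<lambda>t \<omega>. Y t \<omega> * X t \<omega>) I"
    and XI: "AE \<omega> in M. \<forall>u\<in>{0..T}. X u \<omega> = x0 + I u \<omega>"
    by (rule X_integral_equation)
  from I obtain n \<tau> \<xi> where simple: "\<And>k. simple_integrand M F T (n k) (\<tau> k) (\<xi> k)"
    and U: "tends_to_0_in_probability M (\<lambda>k \<omega>. \<integral>\<^sup>+u\<in>{0..T}.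
        ennreal ((simple_process (n k) (\<tau> k) (\<xi> k) u \<omega> - Y u \<omega> * X u \<omega>)\<^sup>2) \<partial>lborel)"
    and D: "tends_to_0_in_probability M
        (\<lambda>k \<omega>. SUP t\<in>{0..T}. ennreal \<bar>simple_integral W (n k) (\<tau> k) (\<xi> k) t \<omega> - I t \<omega>\<bar>)"
    unfolding ito_integral_def by blast
  define Uk where "Uk = (\<lambda>k \<omega>. \<integral>\<^sup>+u\<in>{0..T}.
        ennreal ((simple_process (n k) (\<tau> k) (\<xi> k) u \<omega> - Y u \<omega> * X u \<omega>)\<^sup>2) \<partial>lborel)"
  define Dk where "Dk = (\<lambda>k \<omega>. SUP t\<in>{0..T}. ennreal \<bar>simple_integral W (n k) (\<tau> k) (\<xi> k) t \<omega> - I t \<omega>\<bar>)"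
  have Uk_meas [measurable]: "Uk k \<in> borel_measurable M" and Dk_meas [measurable]: "Dk k \<in> borel_measurable M" for k
    using U D unfolding tends_to_0_in_probability_def Uk_def Dk_def by blast+
  have "(\<lambda>k. prob {\<omega> \<in> space M. ennreal (\<epsilon> / 4) < Uk k \<omega>}) \<longlonglongrightarrow> 0"
    using U \<epsilon>(1) unfolding tends_to_0_in_probability_def Uk_def by simp
  from order_tendstoD(2)[OF this, of "\<eta> / 4"]
  have small1: "eventually (\<lambda>k. prob {\<omega> \<in> space M. ennreal (\<epsilon> / 4) < Uk k \<omega>} < \<eta> / 4) sequentially"
    using \<eta> by simp
  have "(\<lambda>k. prob {\<omega> \<in> space M. ennreal \<epsilon> < Dk k \<omega>}) \<longlonglongrightarrow> 0"
    using D \<epsilon>(1) unfolding tends_to_0_in_probability_def Dk_def by simp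
  from order_tendstoD(2)[OF this, of "\<eta> / 4"]
  have small2: "eventually (\<lambda>k. prob {\<omega> \<in> space M. ennreal \<epsilon> < Dk k \<omega>} < \<eta> / 4) sequentially"
    using \<eta> by simp
  \<comment> \<open>The integrand is fixed before any grid is drawn: its bound \<open>C\<close> and
    its jump times determine how fine the grid must be.\<close>
  obtain k where k: "prob {\<omega> \<in> space M. ennreal (\<epsilon> / 4) < Uk k \<omega>} < \<eta> / 4"
      "prob {\<omega> \<in> space M. ennreal \<epsilon> < Dk k \<omega>} < \<eta> / 4"
    using eventually_happens[OF eventually_conj[OF small1 small2]] by auto
  define p where "p = simple_process (n k) (\<tau> k) (\<xi> k)"
  obtain C where C: "\<And>u \<omega>. \<omega> \<in> space M \<Longrightarrow> \<bar>p u \<omega>\<bar> \<le> C"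
    unfolding p_def using simple_integrand_bound[OF simple] by blast
  define h where "h = (\<lambda>m. 1 / real (Suc m))"
  have h_lim: "h \<longlonglongrightarrow> 0"
    unfolding h_def by (rule LIMSEQ_Suc[OF lim_1_over_n])
  have "\<exists>N s. s 0 = 0 \<and> s N = t \<and> (\<forall>j<N. s j < s (Suc j) \<and> s (Suc j) - s j \<le> h m \<and>
      (\<forall>q\<in>\<tau> k ` {..n k}. q \<le> s j \<or> s (Suc j) \<le> q))" for m
    using t by (intro fine_grid_avoiding_finite_set) (auto simp: h_def)
  then obtain N s where s0: "\<And>m. s m 0 = 0" and sN: "\<And>m. s m (N m) = t"
    and s_step: "\<And>m j. j < N m \<Longrightarrow> s m j < s m (Suc j) \<and> s m (Suc j) - s m j \<le> h m"
    and s_avoid: "\<And>m j i. j < N m \<Longrightarrow> i \<le> n k \<Longrightarrow> \<tau> k i \<le> s m j \<or> s m (Suc j) \<le> \<tau> k i"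
    by (metis atMost_iff imageI)
  have s_mono: "s m i \<le> s m j" if "i \<le> j" "j \<le> N m" for m i j
    using mono_upto_if_Suc[of "N m" "s m" i j] s_step less_imp_le that by blast
  have s_range: "s m i \<in> {0..T}" if "i \<le> N m" for m i
    using s_mono[of 0 i m] s_mono[of i "N m" m] that s0 sN t by auto
  define R where "R = (\<lambda>m \<omega>. \<Sum>j<N m. (s m (Suc j) - s m j) *
    (p (s m (Suc j)) \<omega> - Y (s m j) \<omega> * X (s m j) \<omega>)\<^sup>2)"
  have p_meas: "p (s m (Suc j)) \<in> borel_measurable (F (s m j))" if "j < N m" for m j
    unfolding p_def
    using that s_range[of j m] s_range[of "Suc j" m] s_step[of j m] s_avoid[of j m]
    by (intro simple_process_left_measurable[OF simple]) auto
  have "R m \<in> borel_measurable M" for m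
    unfolding R_def
  proof (intro borel_measurable_sum borel_measurable_times borel_measurable_power
      borel_measurable_diff borel_measurable_const)
    fix j assume "j \<in> {..<N m}"
    then have j: "j < N m" "s m j \<in> {0..T}"
      using s_range[of j m] by auto
    show "p (s m (Suc j)) \<in> borel_measurable M" "Y (s m j) \<in> borel_measurable M"
        "X (s m j) \<in> borel_measurable M"
      using p_meas[OF j(1)] X_adapted Y_adapted j(2) unfolding adapted_def
      by (blast intro: measurable_filtration)+
  qed
  note [measurable] = this
  \<comment> \<open>The threshold is relative to \<open>Uk k\<close>, so that almost every path
    leaves \<open>A m\<close> for large m whatever its L2 error. Where \<open>Uk k\<close> is at
    most \<epsilon>/4, the grid error off \<open>A m\<close> is at most 2 (\<epsilon>/4) +
    \<epsilon>/2 = \<epsilon>.\<close>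
  define A where "A = (\<lambda>m. {\<omega> \<in> space M. 2 * Uk k \<omega> + ennreal (\<epsilon> / 2) < ennreal (R m \<omega>)})"
  have A_meas [measurable]: "A m \<in> sets M" for m
    unfolding A_def by measurable
  have "AE \<omega> in M. eventually (\<lambda>m. \<omega> \<notin> A m) sequentially"
  proof -
    have "AE \<omega> in M. continuous_on {0..T} (\<lambda>u. X u \<omega>)" "AE \<omega> in M. continuous_on {0..T} (\<lambda>u. Y u \<omega>)"
      using X_equation Y_solution
      by (simp_all add: unique_strong_solution_def strong_solution_def ito_process_def continuous_paths_def)
    then show ?thesis
    proof eventually_elim
      case (elim \<omega>)
      define H where "H = (\<lambda>u. Y u \<omega> * X u \<omega>)"
      have H: "continuous_on {0..T} H"
        unfolding H_def using elim by (intro continuous_intros)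
      \<comment> \<open>Chosen so that the oscillation term 2 \<theta>^2 T of the grid estimate
        equals \<epsilon>/2.\<close>
      define \<theta> where "\<theta> = sqrt (\<epsilon> / (4 * T))"
      have \<theta>: "0 < \<theta>" "2 * \<theta>\<^sup>2 * T = \<epsilon> / 2"
        using horizon_pos \<epsilon> by (auto simp: \<theta>_def)
      from compact_uniformly_continuous[OF H compact_Icc] \<theta>(1) obtain d where d: "0 < d"
        "\<And>u v. u \<in> {0..T} \<Longrightarrow> v \<in> {0..T} \<Longrightarrow> \<bar>u - v\<bar> < d \<Longrightarrow> \<bar>H u - H v\<bar> < \<theta>"
        unfolding uniformly_continuous_on_def dist_real_def by (metis abs_minus_commute)
      have "eventually (\<lambda>m. h m < d) sequentially"
        using order_tendstoD(2)[OF h_lim d(1)] .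
      then show ?case
      proof eventually_elim
        case (elim m)
        have "ennreal (R m \<omega>) \<le> 2 * Uk k \<omega> + ennreal (2 * \<theta>\<^sup>2 * T)"
          unfolding R_def Uk_def p_def[symmetric] H_def[symmetric, THEN fun_cong]
        proof (rule riemann_sum_error_le[where p = "\<lambda>u. p u \<omega>" and H = H])
          show "(\<lambda>u. p u \<omega>) \<in> borel_measurable borel"
            unfolding p_def by (rule borel_measurable_simple_process_time)
          show "continuous_on {0..T} H"
            by (rule H)
          show "s m j \<le> s m (Suc j)" if "j < N m" for j
            using s_step[OF that] by simp
          fix j u assume ju: "j < N m" "s m j < u" "u \<le> s m (Suc j)"
          show "p u \<omega> = p (s m (Suc j)) \<omega>"
            unfolding p_def using ju by (intro simple_process_constant[of "n k" "\<tau> k" "s m j"] s_avoid)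
          have "u \<in> {0..T}" "s m j \<in> {0..T}" "\<bar>u - s m j\<bar> < d"
            using ju s_range[of j m] s_range[of "Suc j" m] s_step[OF ju(1)] elim by auto
          from d(2)[OF this] show "\<bar>H u - H (s m j)\<bar> \<le> \<theta>"
            by simp
        qed (use s0 sN t horizon_pos in auto)
        then show ?case
          by (simp add: A_def \<theta> not_less)
      qed
    qed
  qed
  then have "(\<lambda>m. prob (A m)) \<longlonglongrightarrow> 0"
    by (intro AE_eventually_imp_prob_tendsto_0 A_meas)
  then have ev1: "eventually (\<lambda>m. prob (A m) < \<eta> / 4) sequentially"
    using \<eta> by (intro order_tendstoD(2)) auto
  have "(\<lambda>m. exp (12 * K\<^sup>2 * t) * (2 * C ^ 3 * sqrt (h m) * t)) \<longlonglongrightarrow> exp (12 * K\<^sup>2 * t) * (2 * C ^ 3 * sqrt 0 * t)"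
    by (intro tendsto_intros h_lim)
  then have ev2: "eventually (\<lambda>m. exp (12 * K\<^sup>2 * t) * (2 * C ^ 3 * sqrt (h m) * t) < c * \<eta> / 8) sequentially"
    by (rule order_tendstoD(2)) (use c \<eta> in simp)
  obtain m where m: "prob (A m) < \<eta> / 4" "exp (12 * K\<^sup>2 * t) * (2 * C ^ 3 * sqrt (h m) * t) < c * \<eta> / 8"
    using eventually_happens[OF eventually_conj[OF ev1 ev2]] by auto
  obtain V where V_meas [measurable]: "V \<in> borel_measurable M" and V_int: "integrable M (\<lambda>\<omega>. neg_part (V \<omega>) ^ 3)"
    and EV: "expectation (\<lambda>\<omega>. neg_part (V \<omega>) ^ 3) \<le>
       exp (12 * K\<^sup>2 * t) * ((6 + 12 * K\<^sup>2 * t) * (K + 1) * \<epsilon> + 2 * C ^ 3 * sqrt (h m) * t)"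
    and V_eq: "\<And>\<omega> S. \<lbrakk>S 0 = x0; \<And>i. i < N m \<Longrightarrow> S (Suc i) = S i + p (s m (Suc i)) \<omega> * (W (s m (Suc i)) \<omega> - W (s m i) \<omega>);
        \<And>i. i < N m \<Longrightarrow> \<bar>S i - X (s m i) \<omega>\<bar> \<le> \<epsilon> \<and> \<bar>X (s m i) \<omega>\<bar> \<le> K \<and> \<bar>Y (s m i) \<omega>\<bar> \<le> K;
        (\<Sum>l<N m. (s m (Suc l) - s m l) * (p (s m (Suc l)) \<omega> - Y (s m l) \<omega> * X (s m l) \<omega>)\<^sup>2) \<le> \<epsilon>\<rbrakk> \<Longrightarrow> V \<omega> = S (N m)"
    using t by (rule_tac stopped_approximation[where s = "s m" and n = "N m" and t = t and h = "h m"
        and \<zeta> = "\<lambda>i. p (s m (Suc i))" and C = C, OF s0 sN _ s_step p_meas C K \<epsilon>(1,2)]) auto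
  have EV': "expectation (\<lambda>\<omega>. neg_part (V \<omega>) ^ 3) \<le> c * \<eta> / 4"
    using EV G\<epsilon> m(2) by (simp add: G_def algebra_simps)
  define L where "L = {\<omega> \<in> space M. c \<le> neg_part (V \<omega>) ^ 3}"
  have "prob L \<le> expectation (\<lambda>\<omega>. neg_part (V \<omega>) ^ 3) / c"
    unfolding L_def by (rule integral_Markov_inequality_measure[OF V_int sets.empty_sets _ c]) auto
  also have "\<dots> \<le> \<eta> / 4"
    using EV' c by (simp add: field_simps)
  finally have L: "prob L \<le> \<eta> / 4" .
  have L_meas [measurable]: "L \<in> sets M"
    unfolding L_def by measurable
  define B where "B = ({\<omega> \<in> space M. ennreal (\<epsilon> / 4) < Uk k \<omega>} \<union> {\<omega> \<in> space M. ennreal \<epsilon> < Dk k \<omega>}) \<union> (A m \<union> L)"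
  show ?thesis
  proof (rule that[of B])
    show "B \<in> sets M"
      unfolding B_def by measurable
    have "prob B \<le> prob ({\<omega> \<in> space M. ennreal (\<epsilon> / 4) < Uk k \<omega>} \<union> {\<omega> \<in> space M. ennreal \<epsilon> < Dk k \<omega>}) + prob (A m \<union> L)"
      unfolding B_def by (rule measure_Un_le) measurable
    moreover have "prob ({\<omega> \<in> space M. ennreal (\<epsilon> / 4) < Uk k \<omega>} \<union> {\<omega> \<in> space M. ennreal \<epsilon> < Dk k \<omega>}) \<le>
        prob {\<omega> \<in> space M. ennreal (\<epsilon> / 4) < Uk k \<omega>} + prob {\<omega> \<in> space M. ennreal \<epsilon> < Dk k \<omega>}"
      by (rule measure_Un_le) measurable
    moreover have "prob (A m \<union> L) \<le> prob (A m) + prob L"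
      by (rule measure_Un_le) measurable
    ultimately show "prob B \<le> \<eta>"
      using k m(1) L by linarith
    show "AE \<omega> in M. \<omega> \<notin> B \<longrightarrow> (\<forall>u\<in>{0..T}. \<bar>X u \<omega>\<bar> \<le> K \<and> \<bar>Y u \<omega>\<bar> \<le> K) \<longrightarrow> - a \<le> X t \<omega>"
      using XI AE_space
    proof eventually_elim
      case (elim \<omega>)
      show ?case
      proof (intro impI)
        assume \<omega>: "\<omega> \<notin> B" and bd: "\<forall>u\<in>{0..T}. \<bar>X u \<omega>\<bar> \<le> K \<and> \<bar>Y u \<omega>\<bar> \<le> K"
        \<comment> \<open>The approximation without stopping, read at grid points. Outside
          \<open>B\<close> and with paths bounded by \<open>K\<close> the rule never refuses a step,
          so it ends at the value of \<open>V\<close>.\<close>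
        define S where "S = (\<lambda>i. x0 + simple_integral W (n k) (\<tau> k) (\<xi> k) (s m i) \<omega>)"
        have near: "\<bar>S i - X (s m i) \<omega>\<bar> \<le> \<epsilon>" if "i \<le> N m" for i
        proof -
          have "ennreal \<bar>simple_integral W (n k) (\<tau> k) (\<xi> k) (s m i) \<omega> - I (s m i) \<omega>\<bar> \<le> Dk k \<omega>"
            unfolding Dk_def by (rule SUP_upper[OF s_range[OF that]])
          also have "\<dots> \<le> ennreal \<epsilon>"
            using \<omega> elim by (auto simp: B_def not_less)
          finally show ?thesis
            using elim s_range[OF that] \<epsilon>(1) by (simp add: S_def)
        qed
        have "V \<omega> = S (N m)"
        proof (rule V_eq)
          have "0 \<le> \<tau> k i" if "i \<le> n k" for i
            using simple_integrand_grid_mono[OF simple, of 0 i k] simple[of k] that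
            by (auto simp: simple_integrand_def)
          then show "S 0 = x0"
            by (simp add: S_def s0 simple_integral_def min_absorb1)
          show "S (Suc i) = S i + p (s m (Suc i)) \<omega> * (W (s m (Suc i)) \<omega> - W (s m i) \<omega>)" if "i < N m" for i
            using simple_integral_increment[of "n k" "\<tau> k" "s m i" "s m (Suc i)" W "\<xi> k" \<omega>]
              simple[of k] s_avoid[OF that] s_step[OF that]
            by (simp add: S_def p_def simple_integrand_def)
          show "\<bar>S i - X (s m i) \<omega>\<bar> \<le> \<epsilon> \<and> \<bar>X (s m i) \<omega>\<bar> \<le> K \<and> \<bar>Y (s m i) \<omega>\<bar> \<le> K" if "i < N m" for i
            using near[of i] s_range[of i m] bd that by auto
          have "ennreal (R m \<omega>) \<le> 2 * Uk k \<omega> + ennreal (\<epsilon> / 2)"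
            using \<omega> elim by (auto simp: B_def A_def not_less)
          also have "\<dots> \<le> 2 * ennreal (\<epsilon> / 4) + ennreal (\<epsilon> / 2)"
            using \<omega> elim by (intro add_right_mono mult_left_mono) (auto simp: B_def not_less)
          also have "\<dots> = ennreal (2 * (\<epsilon> / 4) + \<epsilon> / 2)"
          proof -
            have "2 * ennreal (\<epsilon> / 4) = ennreal (2 * (\<epsilon> / 4))"
              using \<epsilon>(1) by (subst ennreal_mult) auto
            then show ?thesis
              using \<epsilon>(1) by (subst ennreal_plus) auto
          qed
          finally show "(\<Sum>l<N m. (s m (Suc l) - s m l) *
              (p (s m (Suc l)) \<omega> - Y (s m l) \<omega> * X (s m l) \<omega>)\<^sup>2) \<le> \<epsilon>"
            using \<epsilon>(1) by (simp add: R_def)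
        qed
        then have "\<bar>V \<omega> - X t \<omega>\<bar> \<le> a / 2"
          using near[of "N m"] sN[of m] \<epsilon>(3) by simp
        moreover have "neg_part (V \<omega>) ^ 3 < (a / 2) ^ 3"
          using \<omega> elim by (auto simp: B_def L_def c_def not_le)
        then have "neg_part (V \<omega>) < a / 2"
          by (rule power_less_imp_less_base) (use a in simp)
        ultimately show "- a \<le> X t \<omega>"
          unfolding neg_part_def by linarith
      qed
    qed
  qed
qed

text \<open>For a fixed path bound and tolerance the exceptional events can be made arbitrarily
  small, so their intersection is null. Countably many bounds and tolerances suffice, since
  continuous paths on a compact interval are bounded.\<close>

lemma X_nonneg:
  assumes t: "t \<in> {0..T}"
  shows "AE \<omega> in M. 0 \<le> X t \<omega>"
proof -
  have "AE \<omega> in M. (\<forall>u\<in>{0..T}. \<bar>X u \<omega>\<bar> \<le> real K \<and> \<bar>Y u \<omega>\<bar> \<le> real K) \<longrightarrow> - (1 / real (Suc j)) \<le> X t \<omega>"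
    for K j
  proof -
    have ex: "\<exists>N. N \<in> sets M \<and> prob N \<le> 1 / real (Suc r) \<and>
        (AE \<omega> in M. \<omega> \<notin> N \<longrightarrow> (\<forall>u\<in>{0..T}. \<bar>X u \<omega>\<bar> \<le> real K \<and> \<bar>Y u \<omega>\<bar> \<le> real K) \<longrightarrow>
          - (1 / real (Suc j)) \<le> X t \<omega>)" for r
    proof -
      have pos: "0 \<le> real K" "0 < 1 / real (Suc j)" "0 < 1 / real (Suc r)"
        by auto
      show ?thesis
        by (rule X_ge_outside_small_event[OF t pos]) (rule exI, intro conjI)
    qed
    from choice[OF allI[OF ex]] obtain N where N: "\<forall>r. N r \<in> sets M \<and> prob (N r) \<le> 1 / real (Suc r) \<and>
        (AE \<omega> in M. \<omega> \<notin> N r \<longrightarrow> (\<forall>u\<in>{0..T}. \<bar>X u \<omega>\<bar> \<le> real K \<and> \<bar>Y u \<omega>\<bar> \<le> real K) \<longrightarrow>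
          - (1 / real (Suc j)) \<le> X t \<omega>)" ..
    have N_sets: "N r \<in> sets M" for r
      by (rule N[rule_format, THEN conjunct1])
    have "prob (\<Inter>r. N r) \<le> 1 / real (Suc r)" for r
    proof -
      have "prob (\<Inter>r. N r) \<le> prob (N r)"
        using N_sets by (intro finite_measure_mono) auto
      with N[rule_format, THEN conjunct2, THEN conjunct1, of r] show ?thesis by linarith
    qed
    then have "prob (\<Inter>r. N r) \<le> 0"
      by (intro LIMSEQ_le_const[OF LIMSEQ_Suc[OF lim_1_over_n]] exI[of _ 0] allI impI)
    then have "emeasure M (\<Inter>r. N r) = 0"
      by (simp add: emeasure_eq_measure measure_le_0_iff)
    moreover have "(\<Inter>r. N r) \<in> sets M"
      using N_sets by (intro sets.countable_INT) auto
    ultimately have "(\<Inter>r. N r) \<in> null_sets M"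
      by (rule null_setsI)
    then have "AE \<omega> in M. \<omega> \<notin> (\<Inter>r. N r)"
      by (rule AE_not_in)
    moreover have "AE \<omega> in M. \<forall>r. \<omega> \<notin> N r \<longrightarrow> (\<forall>u\<in>{0..T}. \<bar>X u \<omega>\<bar> \<le> real K \<and> \<bar>Y u \<omega>\<bar> \<le> real K) \<longrightarrow>
          - (1 / real (Suc j)) \<le> X t \<omega>"
      unfolding AE_all_countable by (rule allI, rule N[rule_format, THEN conjunct2, THEN conjunct2])
    ultimately show ?thesis
      by eventually_elim blast
  qed
  then have "AE \<omega> in M. \<forall>K j. (\<forall>u\<in>{0..T}. \<bar>X u \<omega>\<bar> \<le> real K \<and> \<bar>Y u \<omega>\<bar> \<le> real K) \<longrightarrow>
      - (1 / real (Suc j)) \<le> X t \<omega>"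
    unfolding AE_all_countable by blast
  moreover have "AE \<omega> in M. continuous_on {0..T} (\<lambda>u. X u \<omega>)" "AE \<omega> in M. continuous_on {0..T} (\<lambda>u. Y u \<omega>)"
    using X_equation Y_solution
    by (simp_all add: unique_strong_solution_def strong_solution_def ito_process_def continuous_paths_def)
  ultimately show ?thesis
  proof eventually_elim
    case (elim \<omega>)
    have "bounded ((\<lambda>u. X u \<omega>) ` {0..T})" "bounded ((\<lambda>u. Y u \<omega>) ` {0..T})"
      using elim by (auto intro!: compact_imp_bounded compact_continuous_image)
    then obtain b1 b2 where "\<forall>u\<in>{0..T}. \<bar>X u \<omega>\<bar> \<le> b1" "\<forall>u\<in>{0..T}. \<bar>Y u \<omega>\<bar> \<le> b2"
      by (auto simp: bounded_iff)
    moreover obtain K :: nat where "max b1 b2 \<le> real K"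
      using real_arch_simple by blast
    ultimately have "\<forall>u\<in>{0..T}. \<bar>X u \<omega>\<bar> \<le> real K \<and> \<bar>Y u \<omega>\<bar> \<le> real K"
      by (metis max.bounded_iff order_trans)
    then have "- (1 / real (Suc j)) \<le> X t \<omega>" for j
      using elim(1) by blast
    then have "- X t \<omega> \<le> 1 / real (Suc j)" for j
      by (metis minus_le_iff)
    then have "- X t \<omega> \<le> 0"
      by (intro LIMSEQ_le_const[OF LIMSEQ_Suc[OF lim_1_over_n]] exI[of _ 0] allI impI)
    then show ?case by simp
  qed
qed

end

section \<open>The Laplace transform of the price as an exponential payoff\<close>

theorem corollary5p2:
  fixes M :: "'a measure" and F :: "real \<Rightarrow> 'a measure" and T \<rho> x0 y0 t lam :: real
    and W Z X Y :: "real \<Rightarrow> 'a \<Rightarrow> real" and \<mu> \<sigma> :: "real \<Rightarrow> real \<Rightarrow> real"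
    and T_lam :: "'a \<Rightarrow> real"
  assumes "linear_stochastic_volatility_model M F T W Z \<rho> \<mu> \<sigma> x0 y0 X Y"
    and "t \<in> {0..T}" and "0 < lam"
    and "distributed M lborel T_lam (exponential_density lam)"
    and "prob_space.indep_set M {T_lam -` E \<inter> space M | E. E \<in> sets borel}
           (sigma_sets (space M) (path_events M X T))"
  shows "prob_space.expectation M (\<lambda>\<omega>. exp (- lam * X t \<omega>)) =
         lam * prob_space.expectation M (\<lambda>\<omega>. max (T_lam \<omega> - X t \<omega>) 0)"
proof -
  interpret linear_stochastic_volatility_model M F T W Z \<rho> \<mu> \<sigma> x0 y0 X Y
    by fact
  have T_lam [measurable]: "T_lam \<in> borel_measurable M"
    using assms(4) by (auto simp: distributed_def)
  have X [measurable]: "X t \<in> borel_measurable M"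
    using X_adapted assms(2) unfolding adapted_def by (blast intro: measurable_filtration)
  \<comment> \<open>Only independence from the single variable \<open>X t\<close> is used; its
    events are among the generators of the path sigma-algebra because t lies in [0,T].\<close>
  have "indep_var borel T_lam borel (X t)"
  proof (rule indep_var_if_indep_set[OF assms(5) T_lam X])
    show "X t -` E \<inter> space M \<in> sigma_sets (space M) (path_events M X T)" if "E \<in> sets borel" for E
      using that assms(2) by (intro sigma_sets.Basic) (auto simp: path_events_def)
  qed
  then have "(\<integral>\<^sup>+\<omega>. ennreal (max (T_lam \<omega> - X t \<omega>) 0) \<partial>M) = (\<integral>\<^sup>+\<omega>. ennreal (exp (- lam * X t \<omega>) / lam) \<partial>M)"
    by (rule nn_integral_indep_exponential[OF _ assms(4,3) X_nonneg[OF assms(2)]])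
  \<comment> \<open>Both integrands are measurable and nonnegative, so each expectation is the real
    value of its nonnegative integral and the equality carries over.\<close>
  then have "expectation (\<lambda>\<omega>. max (T_lam \<omega> - X t \<omega>) 0) = expectation (\<lambda>\<omega>. exp (- lam * X t \<omega>) / lam)"
    using assms(3) by (subst (1 2) integral_eq_nn_integral) auto
  then show ?thesis
    using assms(3) by simp
qed

end
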